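(* Let $\mathbb{S}$ be a commutative semigroup with identity $e$, and let $\mathbb{S}'$ be the space of all non-zero multiplicative functions $\varrho:\mathbb{S}\to\mathbb{C}$ with the topology of pointwise convergence. Let $\mu$ be a compactly supported complex regular Borel measure on $\mathbb{S}'$ such that $\mu(\mathbb{S}')\neq 0$, and let $$\gamma(s):=\frac{1}{\mu(\mathbb{S}')}\int_{\mathbb{S}'}\varrho(s)\,d\mu(\varrho),\qquad s\in\mathbb{S}.$$ Then $\mu$ satisfies the equality $$\mu(\mathbb{S}')\int_{\mathbb{S}'}\varrho(s)\overline{\varrho(t)}\,d\mu(\varrho)=\int_{\mathbb{S}'}\varrho(s)\,d\mu(\varrho)\int_{\mathbb{S}'}\overline{\varrho(t)}\,d\mu(\varrho)$$ for all $s,t\in\mathbb{S}$ if and only if $\gamma\in\mathbb{S}'$ and $\mu=\mu(\mathbb{S}')\,\delta_\gamma$.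
   Context: A function $\varrho:\mathbb{S}\to\mathbb{C}$ is multiplicative if $\varrho(st)=\varrho(s)\varrho(t)$ for all $s,t\in\mathbb{S}$; a non-zero multiplicative function satisfies $\varrho(e)=1$. $\delta_\gamma$ is the Dirac measure at $\gamma$. *)

theory Defs
  imports "HOL-Analysis.Analysis"
begin

definition multiplicative :: "('s::comm_monoid_mult \<Rightarrow> complex) \<Rightarrow> bool" where
  "multiplicative \<rho> \<longleftrightarrow> (\<forall>s t. \<rho> (s * t) = \<rho> s * \<rho> t)"

(* The topology on this set is the one induced by the topology of the function type
   's => complex (HOL-Analysis.Function_Topology), i.e. the topology of pointwise convergence. *)
definition nonzero_mult :: "('s::comm_monoid_mult \<Rightarrow> complex) set" where
  "nonzero_mult = {\<rho>. multiplicative \<rho> \<and> \<rho> \<noteq> (\<lambda>_. 0)}"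

(* The Borel sigma-algebra of the subspace S; it is generated by the relatively open sets.
   Only space and sets of this measure are ever used. *)
abbreviation borel_on :: "'b::topological_space set \<Rightarrow> 'b measure" where
  "borel_on S \<equiv> restrict_space borel S"

(* A complex measure is a countably additive complex set function on sets M; its values
   outside sets M are irrelevant. Finiteness of the total variation is a consequence. *)
definition complex_measure :: "'b measure \<Rightarrow> ('b set \<Rightarrow> complex) \<Rightarrow> bool" where
  "complex_measure M \<mu> \<longleftrightarrow>
     (\<forall>A :: nat \<Rightarrow> 'b set. range A \<subseteq> sets M \<longrightarrow> disjoint_family A \<longrightarrow>
        (\<lambda>n. \<mu> (A n)) sums \<mu> (\<Union>n. A n))"

(* |mu|(E): supremum over all countable measurable partitions of E. *)
definition total_variation :: "'b measure \<Rightarrow> ('b set \<Rightarrow> complex) \<Rightarrow> 'b set \<Rightarrow> ennreal" where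
  "total_variation M \<mu> E =
     (SUP A \<in> {A :: nat \<Rightarrow> 'b set. range A \<subseteq> sets M \<and> disjoint_family A \<and> (\<Union>n. A n) = E}.
        \<Sum>n. ennreal (cmod (\<mu> (A n))))"

definition regular_on :: "'b::topological_space set \<Rightarrow> ('b set \<Rightarrow> complex) \<Rightarrow> bool" where
  "regular_on S \<mu> \<longleftrightarrow>
     (\<forall>E \<in> sets (borel_on S).
        total_variation (borel_on S) \<mu> E =
          (INF U \<in> {U. openin (top_of_set S) U \<and> E \<subseteq> U}. total_variation (borel_on S) \<mu> U) \<and>
        total_variation (borel_on S) \<mu> E =
          (SUP K \<in> {K. compact K \<and> K \<subseteq> E}. total_variation (borel_on S) \<mu> K))"

definition measure_support :: "'b::topological_space set \<Rightarrow> ('b set \<Rightarrow> complex) \<Rightarrow> 'b set" where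
  "measure_support S \<mu> =
     {x \<in> S. \<forall>U. openin (top_of_set S) U \<longrightarrow> x \<in> U \<longrightarrow> total_variation (borel_on S) \<mu> U \<noteq> 0}"

(* Positive part of the Jordan decomposition of a real measure nu:
   nu^+(E) = sup {nu(A) | A measurable, A \<subseteq> E}.  The negative part is (-nu)^+.
   Negative values are truncated to 0 by ennreal, harmlessly since nu({}) = 0. *)
definition positive_part :: "'b measure \<Rightarrow> ('b set \<Rightarrow> real) \<Rightarrow> 'b measure" where
  "positive_part M \<nu> =
     measure_of (space M) (sets M) (\<lambda>E. SUP A \<in> {A \<in> sets M. A \<subseteq> E}. ennreal (\<nu> A))"

(* Integral against a complex measure, by linearity from the four finite positive measures
   in mu = (Re mu)^+ - (Re mu)^- + i ((Im mu)^+ - (Im mu)^-). *)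
definition complex_integral ::
    "'b measure \<Rightarrow> ('b set \<Rightarrow> complex) \<Rightarrow> ('b \<Rightarrow> complex) \<Rightarrow> complex" where
  "complex_integral M \<mu> f =
     (integral\<^sup>L (positive_part M (\<lambda>E. Re (\<mu> E))) f
        - integral\<^sup>L (positive_part M (\<lambda>E. - Re (\<mu> E))) f)
     + \<i> * (integral\<^sup>L (positive_part M (\<lambda>E. Im (\<mu> E))) f
        - integral\<^sup>L (positive_part M (\<lambda>E. - Im (\<mu> E))) f)"

definition dirac :: "'b \<Rightarrow> 'b set \<Rightarrow> complex" where
  "dirac x E = indicator E x"

end

theory Submission
  imports Defs
begin

text \<open>
  Write \<open>L f = (\<integral> f d\<mu>) / \<mu>(S')\<close> and \<open>LL\<close> for the iterated functional on functions of two
  characters. The hypothesis makes \<open>LL (F * cnj H)\<close> split as \<open>LL F * LL (cnj H)\<close> for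
  holomorphic polynomials \<open>F\<close>, \<open>H\<close> in two characters, so it vanishes as soon as one factor is
  antisymmetric. As in Luecking's theorem on finite rank Toeplitz operators, applying this to powers of
  \<open>p(x, y) = f(x) - f(y)\<close> gives \<open>LL (p\<^sup>2) = 0\<close>, that is \<open>L (f\<^sup>2) = (L f)\<^sup>2\<close>. Hence \<open>L\<close> is
  multiplicative on the star-algebra generated by the evaluations. Being bounded by a multiple of the
  supremum norm on the compact support, it is the evaluation at a point of the support, which must be
  \<open>\<gamma>\<close>; inner regularity and Stone--Weierstrass approximation then show that \<open>\<mu>\<close> vanishes on all Borel
  sets avoiding \<open>\<gamma>\<close>.
\<close>

section \<open>Signed and complex measures\<close>

text \<open>For a positive measure, the hypothesis makes the variance of every evaluation vanish and
  the claim follows at once. For complex \<open>\<mu>\<close> cancellation destroys this: a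
  vanishing integral of \<open>\<bar>g\<bar>^2\<close> says nothing about \<open>g\<close>, and
  \<open>L (cnj g)\<close> need not be the conjugate of \<open>L g\<close>. Working in one variable
  with \<open>g = f - L f\<close> also fails, since \<open>L g = 0\<close> says nothing about higher
  powers of \<open>g\<close>. Doubling the variable cures this: every odd power of an antisymmetric
  \<open>p\<close> is antisymmetric, so infinitely many moments vanish at once.

  The square root arises because \<open>p^2\<close> has modulus \<open>u = p * cnj p\<close>. The
  distance from \<open>p^2\<close> to a combination of the functions \<open>p^2 * u^(2i+1)\<close>
  is therefore the distance from \<open>u\<close> to a combination of the powers
  \<open>u^(2i+2)\<close>. In terms of \<open>v = u^2\<close> this asks for polynomials without
  constant term that approximate \<open>sqrt v\<close>. The weight \<open>u\<close> is what makes it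
  possible on the diagonal, where \<open>p\<close> vanishes.

  Compactness of the support makes \<open>L\<close> bounded. Regularity is what lets the support
  carry the measure, as a union of null open sets may be uncountable.\<close>

locale signed_measure =
  fixes M :: "'b measure" and \<nu> :: "'b set \<Rightarrow> real"
  assumes sums: "\<And>A :: nat \<Rightarrow> 'b set. range A \<subseteq> sets M \<Longrightarrow> disjoint_family A \<Longrightarrow>
    (\<lambda>n. \<nu> (A n)) sums \<nu> (\<Union>n. A n)"
begin

lemma empty: "\<nu> {} = 0"
proof -
  have "(\<lambda>n::nat. \<nu> {}) sums \<nu> {}"
    using sums[of "\<lambda>_. {}"] by (simp add: disjoint_family_on_def)
  then have "(\<lambda>n::nat. \<nu> {}) \<longlonglongrightarrow> 0"
    by (intro summable_LIMSEQ_zero) (simp add: sums_iff)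
  then show ?thesis by (simp add: LIMSEQ_const_iff)
qed

lemma Un:
  assumes "A \<in> sets M" "B \<in> sets M" "A \<inter> B = {}"
  shows "\<nu> (A \<union> B) = \<nu> A + \<nu> B"
proof -
  have "range (binaryset A B) \<subseteq> sets M"
    using assms by (auto simp: binaryset_def)
  moreover have "disjoint_family (binaryset A B)"
    using assms by (auto simp: binaryset_def disjoint_family_on_def)
  ultimately have "(\<lambda>n. \<nu> (binaryset A B n)) sums \<nu> (A \<union> B)"
    using sums[of "binaryset A B"] by (simp add: UN_binaryset_eq)
  moreover have "(\<lambda>n. \<nu> (binaryset A B n)) sums (\<nu> A + \<nu> B)"
    by (rule binaryset_sums) (rule empty)
  ultimately show ?thesis by (rule sums_unique2)
qed

lemma Diff:
  assumes "A \<in> sets M" "B \<in> sets M" "A \<subseteq> B"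
  shows "\<nu> (B - A) = \<nu> B - \<nu> A"
  using Un[of A "B - A"] assms by (simp add: Un_absorb1)

text \<open>Otherwise one can successively remove pieces of measure at least 1 in modulus while keeping a set
  on which the values are still unbounded, which contradicts countable additivity.\<close>

lemma bounded_above: "\<exists>b. \<forall>A\<in>sets M. \<bar>\<nu> A\<bar> \<le> b"
proof (rule ccontr)
  define wild where "wild E \<longleftrightarrow> E \<in> sets M \<and> (\<forall>b. \<exists>A\<in>sets M. A \<subseteq> E \<and> b < \<bar>\<nu> A\<bar>)" for E
  assume "\<not> ?thesis"
  then have "\<exists>A\<in>sets M. b < \<bar>\<nu> A\<bar>" for b
    by (simp add: not_le)
  then have space_wild: "wild (space M)"
    unfolding wild_def by (meson sets.sets_into_space sets.top)
  have split: "wild A \<or> wild B"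
    if E: "wild E" and A: "A \<in> sets M" and B: "B \<in> sets M" and AB: "E = A \<union> B" "A \<inter> B = {}" for E A B
  proof (rule ccontr)
    assume "\<not> (wild A \<or> wild B)"
    then obtain a b where a: "\<And>X. X \<in> sets M \<Longrightarrow> X \<subseteq> A \<Longrightarrow> \<bar>\<nu> X\<bar> \<le> a"
      and b: "\<And>X. X \<in> sets M \<Longrightarrow> X \<subseteq> B \<Longrightarrow> \<bar>\<nu> X\<bar> \<le> b"
      using A B unfolding wild_def by (meson not_le)
    obtain X where X: "X \<in> sets M" "X \<subseteq> E" "a + b < \<bar>\<nu> X\<bar>"
      using E unfolding wild_def by blast
    have "\<nu> X = \<nu> (X \<inter> A) + \<nu> (X \<inter> B)"
      using Un[of "X \<inter> A" "X \<inter> B"] X AB A B by (auto simp flip: Int_Un_distrib simp: Int_absorb2)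
    moreover have "\<bar>\<nu> (X \<inter> A)\<bar> \<le> a" "\<bar>\<nu> (X \<inter> B)\<bar> \<le> b"
      using a b X A B by auto
    ultimately show False using X(3) by linarith
  qed
  have step: "\<exists>E'. wild E' \<and> E' \<subseteq> E \<and> 1 \<le> \<bar>\<nu> (E - E')\<bar>" if E: "wild E" for E
  proof -
    \<comment> \<open>The excess 1 over \<open>\<bar>\<nu> E\<bar>\<close> makes both
      \<open>A\<close> and \<open>E - A\<close> have modulus at least 1, so it does not matter which
      of the two stays wild.\<close>
    obtain A where A: "A \<in> sets M" "A \<subseteq> E" "\<bar>\<nu> E\<bar> + 1 < \<bar>\<nu> A\<bar>"
      using E unfolding wild_def by blast
    have EM: "E \<in> sets M" using E wild_def by blast
    have big: "1 \<le> \<bar>\<nu> A\<bar>" "1 \<le> \<bar>\<nu> (E - A)\<bar>"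
      using A Diff[OF A(1) EM A(2)] by linarith+
    have EA: "E - (E - A) = A" using A(2) by blast
    have "wild A \<or> wild (E - A)"
      by (rule split[OF E A(1)]) (use A EM in auto)
    with big EA A(2) show ?thesis by (metis Diff_subset)
  qed
  obtain F where F: "\<And>n::nat. wild (F n)" "\<And>n. F (Suc n) \<subseteq> F n" "\<And>n. 1 \<le> \<bar>\<nu> (F n - F (Suc n))\<bar>"
    using dependent_nat_choice[of "\<lambda>_. wild" "\<lambda>_ E E'. E' \<subseteq> E \<and> 1 \<le> \<bar>\<nu> (E - E')\<bar>"]
      space_wild step by metis
  define D where "D n = F n - F (Suc n)" for n
  have dec: "decseq F" using F(2) by (simp add: decseq_Suc_iff)
  have "F n \<subseteq> F (Suc m)" if "m < n" for m n
    using dec that by (simp add: decseq_def Suc_leI)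
  then have "disjoint_family D"
    unfolding disjoint_family_on_def D_def by (metis (no_types, lifting) Diff_iff disjoint_iff linorder_neqE_nat subsetD)
  moreover have "range D \<subseteq> sets M"
    using F(1) unfolding D_def wild_def by auto
  ultimately have "(\<lambda>n. \<nu> (D n)) \<longlonglongrightarrow> 0"
    using sums summable_LIMSEQ_zero sums_summable by blast
  then obtain n where "\<bar>\<nu> (D n)\<bar> < 1"
    using LIMSEQ_D[of _ 0 1] by fastforce
  with F(3)[of n] show False by (simp add: D_def)
qed

text \<open>Competitors inside disjoint sets can be united, which gives superadditivity; conversely,
  a competitor for the union is cut along the \<open>E i\<close>, and countable additivity of
  \<open>\<nu>\<close> recovers its value.\<close>

lemma countably_additive_positive_part:
  "countably_additive (sets M) (\<lambda>E. SUP A \<in> {A \<in> sets M. A \<subseteq> E}. ennreal (\<nu> A))"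
  (is "countably_additive _ ?p")
proof (rule countably_additiveI)
  fix E :: "nat \<Rightarrow> 'b set"
  assume E: "range E \<subseteq> sets M" and dj: "disjoint_family E" and "(\<Union>i. E i) \<in> sets M"
  have Em: "E i \<in> sets M" for i using E by auto
  have super: "?p X + ?p Y \<le> ?p (X \<union> Y)" if "X \<inter> Y = {}" for X Y
  proof -
    have "ennreal (\<nu> A) + ennreal (\<nu> B) \<le> ?p (X \<union> Y)"
      if A: "A \<in> sets M" "A \<subseteq> X" and B: "B \<in> sets M" "B \<subseteq> Y" for A B
    proof -
      have upper: "ennreal (\<nu> C) \<le> ?p (X \<union> Y)" if "C \<in> sets M" "C \<subseteq> A \<union> B" for C
        using that A B by (intro SUP_upper) auto
      \<comment> \<open>A nonpositive value is truncated to 0 by \<open>ennreal\<close>, and then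
        the other set alone is a good enough competitor.\<close>
      consider "\<nu> A \<le> 0" | "\<nu> B \<le> 0" | "0 \<le> \<nu> A" "0 \<le> \<nu> B" by linarith
      then show ?thesis
      proof cases
        case 3
        have "A \<inter> B = {}" using A B \<open>X \<inter> Y = {}\<close> by blast
        then have "ennreal (\<nu> A) + ennreal (\<nu> B) = ennreal (\<nu> (A \<union> B))"
          using 3 Un[of A B] A B by (simp add: ennreal_plus)
        then show ?thesis using upper[of "A \<union> B"] A B by simp
      qed (use upper[of A] upper[of B] A B in \<open>auto simp: ennreal_neg\<close>)
    qed
    then have "ennreal (\<nu> A) + ?p Y \<le> ?p (X \<union> Y)" if "A \<in> sets M" "A \<subseteq> X" for A
      using that by (subst ennreal_SUP_add_right) (auto intro!: SUP_least)
    then show ?thesis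
      by (subst ennreal_SUP_add_left[symmetric]) (auto intro!: SUP_least)
  qed
  have partial: "(\<Sum>i<n. ?p (E i)) \<le> ?p (\<Union>i<n. E i)" for n
  proof (induction n)
    case (Suc n)
    have "(\<Union>i<n. E i) \<inter> E n = {}"
      using dj unfolding disjoint_family_on_def by (metis (no_types, lifting) Int_commute UN_E UNIV_I disjoint_iff lessThan_iff nat_neq_iff)
    then have "?p (\<Union>i<n. E i) + ?p (E n) \<le> ?p (\<Union>i<Suc n. E i)"
      using super[of "\<Union>i<n. E i" "E n"] by (simp add: lessThan_Suc Un_commute)
    with Suc show ?case
      by (simp add: add_mono order_trans[OF add_right_mono])
  qed simp
  show "(\<Sum>i. ?p (E i)) = ?p (\<Union>i. E i)"
  proof (rule antisym)
    have mono: "?p X \<le> ?p Y" if "X \<subseteq> Y" for X Y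
      using that by (intro SUP_subset_mono) auto
    have "(\<Sum>i<n. ?p (E i)) \<le> ?p (\<Union>i. E i)" for n
      using partial[of n] mono[of "\<Union>i<n. E i" "\<Union>i. E i"] by (meson UN_mono order_trans subset_UNIV order_refl)
    then show "(\<Sum>i. ?p (E i)) \<le> ?p (\<Union>i. E i)"
      by (intro suminf_le_const) auto
  next
    show "?p (\<Union>i. E i) \<le> (\<Sum>i. ?p (E i))"
    proof (rule SUP_least)
      fix A assume "A \<in> {A \<in> sets M. A \<subseteq> (\<Union>i. E i)}"
      then have A: "A \<in> sets M" "A \<subseteq> (\<Union>i. E i)" by auto
      have "disjoint_family (\<lambda>i. A \<inter> E i)"
        using dj unfolding disjoint_family_on_def by blast
      then have "(\<lambda>i. \<nu> (A \<inter> E i)) sums \<nu> (\<Union>i. A \<inter> E i)"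
        using A Em by (intro sums) auto
      moreover have "(\<Union>i. A \<inter> E i) = A" using A by blast
      ultimately have *: "(\<lambda>n. \<Sum>i<n. \<nu> (A \<inter> E i)) \<longlonglongrightarrow> \<nu> A" by (simp add: sums_def)
      have "ennreal (\<Sum>i<n. \<nu> (A \<inter> E i)) \<le> (\<Sum>i. ?p (E i))" for n
      proof -
        \<comment> \<open>\<open>ennreal\<close> is additive only on nonnegative reals, so negative
          terms are clipped before it is moved inside the sum.\<close>
        have "ennreal (\<Sum>i<n. \<nu> (A \<inter> E i)) \<le> ennreal (\<Sum>i<n. max 0 (\<nu> (A \<inter> E i)))"
          by (intro ennreal_leI sum_mono) auto
        also have "\<dots> = (\<Sum>i<n. ennreal (max 0 (\<nu> (A \<inter> E i))))"
          by (rule sum_ennreal[symmetric]) auto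
        also have "\<dots> = (\<Sum>i<n. ennreal (\<nu> (A \<inter> E i)))"
          by (intro sum.cong) (auto simp: max_def ennreal_neg)
        also have "\<dots> \<le> (\<Sum>i<n. ?p (E i))"
          using A Em by (intro sum_mono SUP_upper) auto
        also have "\<dots> \<le> (\<Sum>i. ?p (E i))"
          by (intro sum_le_suminf) auto
        finally show ?thesis .
      qed
      moreover have "(\<lambda>n. ennreal (\<Sum>i<n. \<nu> (A \<inter> E i))) \<longlonglongrightarrow> ennreal (\<nu> A)"
        using * by (rule tendsto_ennrealI)
      ultimately show "ennreal (\<nu> A) \<le> (\<Sum>i. ?p (E i))"
        by (intro LIMSEQ_le_const2) auto
    qed
  qed
qed

lemma sets_positive_part [measurable_cong]: "sets (positive_part M \<nu>) = sets M"
  and space_positive_part: "space (positive_part M \<nu>) = space M"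
  by (simp_all add: positive_part_def)

text \<open>\<open>measure_of\<close> falls back to the zero measure unless the given set function
  is a measure, hence the countable additivity proved before.\<close>

lemma emeasure_positive_part:
  assumes "E \<in> sets M"
  shows "emeasure (positive_part M \<nu>) E = (SUP A \<in> {A \<in> sets M. A \<subseteq> E}. ennreal (\<nu> A))"
proof (rule emeasure_measure_of[OF positive_part_def])
  show "positive (sets (positive_part M \<nu>)) (\<lambda>E. SUP A \<in> {A \<in> sets M. A \<subseteq> E}. ennreal (\<nu> A))"
    unfolding positive_def using empty by (simp add: sets_positive_part image_constant_conv conj_commute cong: conj_cong)
qed (use assms sets.space_closed in \<open>auto simp: sets_positive_part countably_additive_positive_part\<close>)

lemma finite_measure_positive_part: "finite_measure (positive_part M \<nu>)"
proof
  obtain b where b: "\<forall>A\<in>sets M. \<bar>\<nu> A\<bar> \<le> b" using bounded_above by blast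
  have "(SUP A \<in> {A \<in> sets M. A \<subseteq> space M}. ennreal (\<nu> A)) \<le> ennreal b"
    using b by (intro SUP_least ennreal_leI) (auto simp: abs_le_iff)
  then have "emeasure (positive_part M \<nu>) (space M) \<le> ennreal b"
    by (simp add: emeasure_positive_part)
  then show "emeasure (positive_part M \<nu>) (space (positive_part M \<nu>)) \<noteq> \<infinity>"
    using space_positive_part by (auto simp: top_unique)
qed

lemma le_measure_positive_part:
  assumes "A \<in> sets M" "E \<in> sets M" "A \<subseteq> E"
  shows "\<nu> A \<le> measure (positive_part M \<nu>) E"
proof -
  interpret finite_measure "positive_part M \<nu>" by (rule finite_measure_positive_part)
  have "ennreal (\<nu> A) \<le> ennreal (measure (positive_part M \<nu>) E)"
    using assms by (auto simp: emeasure_positive_part simp flip: emeasure_eq_measure intro: SUP_upper)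
  then show ?thesis by (simp add: ennreal_le_iff)
qed

lemma measure_positive_part_le:
  assumes "E \<in> sets M" "\<And>A. A \<in> sets M \<Longrightarrow> A \<subseteq> E \<Longrightarrow> \<nu> A \<le> b"
  shows "measure (positive_part M \<nu>) E \<le> b"
proof -
  interpret finite_measure "positive_part M \<nu>" by (rule finite_measure_positive_part)
  have "0 \<le> b" using assms(2)[of "{}"] by (simp add: empty)
  moreover have "ennreal (measure (positive_part M \<nu>) E) \<le> ennreal b"
    using assms by (auto simp: emeasure_positive_part simp flip: emeasure_eq_measure intro!: SUP_least ennreal_leI)
  ultimately show ?thesis by (simp add: ennreal_le_iff)
qed

lemma signed_measure_uminus: "signed_measure M (\<lambda>E. - \<nu> E)"
  by standard (intro sums_minus sums)

text \<open>Complementation in \<open>E\<close> exchanges the two parts: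
  \<open>\<nu> A = \<nu> E - \<nu> (E - A)\<close> bounds \<open>\<nu> A\<close> by
  \<open>\<nu> E\<close> plus the negative part, and symmetrically. Taking suprema over
  \<open>A\<close> gives both inequalities.\<close>

lemma jordan_decomposition:
  assumes "E \<in> sets M"
  shows "\<nu> E = measure (positive_part M \<nu>) E - measure (positive_part M (\<lambda>E. - \<nu> E)) E"
proof -
  interpret neg: signed_measure M "\<lambda>E. - \<nu> E" by (rule signed_measure_uminus)
  have "measure (positive_part M \<nu>) E \<le> \<nu> E + measure (positive_part M (\<lambda>E. - \<nu> E)) E"
  proof (rule measure_positive_part_le[OF assms])
    fix A assume "A \<in> sets M" "A \<subseteq> E"
    then show "\<nu> A \<le> \<nu> E + measure (positive_part M (\<lambda>E. - \<nu> E)) E"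
      using neg.le_measure_positive_part[of "E - A" E] Diff[of A E] assms by auto
  qed
  moreover have "measure (positive_part M (\<lambda>E. - \<nu> E)) E \<le> measure (positive_part M \<nu>) E - \<nu> E"
  proof (rule neg.measure_positive_part_le[OF assms])
    fix A assume "A \<in> sets M" "A \<subseteq> E"
    then show "- \<nu> A \<le> measure (positive_part M \<nu>) E - \<nu> E"
      using le_measure_positive_part[of "E - A" E] Diff[of A E] assms by auto
  qed
  ultimately show ?thesis by linarith
qed

end

section \<open>Complex measures as combinations of four finite positive measures\<close>

definition quarter_turns :: "complex set" where
  "quarter_turns = {1, -1, \<i>, -\<i>}"

lemma finite_quarter_turns: "finite quarter_turns"
  and cmod_quarter_turn: "c \<in> quarter_turns \<Longrightarrow> cmod c = 1"
  by (auto simp: quarter_turns_def)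

lemma sum_quarter_turns: "(\<Sum>c\<in>quarter_turns. f c) = f 1 + f (-1) + f \<i> + f (-\<i>)"
  by (simp add: quarter_turns_def complex_eq_iff add_ac)

locale complex_measure_on =
  fixes M :: "'b measure" and \<mu> :: "'b set \<Rightarrow> complex"
  assumes complex_measure: "complex_measure M \<mu>"
begin

text \<open>Rotation by the four quarter turns yields all Jordan parts uniformly: 1 and -1 give
  those of \<open>Re \<mu>\<close>, while \<open>-\<i>\<close> and \<open>\<i>\<close> give the
  positive and negative part of \<open>Im \<mu>\<close>. The coefficient of \<open>part c\<close> in
  \<open>\<mu>\<close> is \<open>cnj c\<close>.\<close>

definition part :: "complex \<Rightarrow> 'b measure" where
  "part c = positive_part M (\<lambda>E. Re (c * \<mu> E))"

text \<open>An additive, finite substitute for the total variation, to which it is equivalent up to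
  the factor 4; all estimates below are made with it.\<close>

definition mass :: "'b set \<Rightarrow> real" where
  "mass E = (\<Sum>c\<in>quarter_turns. measure (part c) E)"

lemma signed_measure_Re: "signed_measure M (\<lambda>E. Re (c * \<mu> E))"
proof
  fix A :: "nat \<Rightarrow> 'b set"
  assume "range A \<subseteq> sets M" "disjoint_family A"
  then show "(\<lambda>n. Re (c * \<mu> (A n))) sums Re (c * \<mu> (\<Union>n. A n))"
    using complex_measure unfolding complex_measure_def by (intro sums_Re sums_mult) auto
qed

lemma sets_part [measurable_cong]: "sets (part c) = sets M"
  and space_part: "space (part c) = space M"
  unfolding part_def
  by (rule signed_measure.sets_positive_part[OF signed_measure_Re]
        signed_measure.space_positive_part[OF signed_measure_Re])+

lemma finite_measure_part: "finite_measure (part c)"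
  unfolding part_def by (rule signed_measure.finite_measure_positive_part[OF signed_measure_Re])

lemma measure_part_le:
  assumes "c \<in> quarter_turns" "E \<in> sets M" "\<And>A. A \<in> sets M \<Longrightarrow> A \<subseteq> E \<Longrightarrow> cmod (\<mu> A) \<le> b"
  shows "measure (part c) E \<le> b"
  unfolding part_def
proof (rule signed_measure.measure_positive_part_le[OF signed_measure_Re assms(2)])
  fix A assume "A \<in> sets M" "A \<subseteq> E"
  then show "Re (c * \<mu> A) \<le> b"
    using complex_Re_le_cmod[of "c * \<mu> A"] assms(1,3) by (force simp: norm_mult cmod_quarter_turn)
qed

lemma mass_nonneg: "0 \<le> mass E"
  by (simp add: mass_def sum_nonneg)

lemma mass_le:
  assumes "E \<in> sets M" "\<And>A. A \<in> sets M \<Longrightarrow> A \<subseteq> E \<Longrightarrow> cmod (\<mu> A) \<le> b"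
  shows "mass E \<le> 4 * b"
proof -
  have "measure (part c) E \<le> b" if "c \<in> quarter_turns" for c
    by (rule measure_part_le[OF that assms])
  from this[of 1] this[of "-1"] this[of \<i>] this[of "-\<i>"] show ?thesis
    by (simp add: mass_def sum_quarter_turns) (simp add: quarter_turns_def)
qed

lemma decomposition:
  assumes "E \<in> sets M"
  shows "\<mu> E = (\<Sum>c\<in>quarter_turns. cnj c * measure (part c) E)"
  using signed_measure.jordan_decomposition[OF signed_measure_Re[of 1] assms]
    signed_measure.jordan_decomposition[OF signed_measure_Re[of "-\<i>"] assms]
  by (auto simp: sum_quarter_turns part_def complex_eq_iff)

lemma cmod_le_mass:
  assumes "E \<in> sets M"
  shows "cmod (\<mu> E) \<le> mass E"
  unfolding decomposition[OF assms] mass_def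
  by (rule order_trans[OF norm_sum]) (simp add: norm_mult cmod_quarter_turn)

lemma complex_integral_eq:
  "complex_integral M \<mu> f = (\<Sum>c\<in>quarter_turns. cnj c * integral\<^sup>L (part c) f)"
  by (simp add: complex_integral_def sum_quarter_turns part_def algebra_simps)

lemma complex_integral_indicator:
  assumes "E \<in> sets M"
  shows "complex_integral M \<mu> (indicator E) = \<mu> E"
proof -
  have "integral\<^sup>L (part c) (indicator E :: 'b \<Rightarrow> complex) = measure (part c) E" for c
  proof -
    have "(indicator E :: 'b \<Rightarrow> complex) = (\<lambda>x. complex_of_real (indicator E x))"
      by (auto simp: indicator_def)
    then show ?thesis
      using assms sets.sets_into_space[of E M] by (simp add: space_part Int_absorb2)
  qed
  then show ?thesis
    unfolding complex_integral_eq by (simp add: decomposition[OF assms])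
qed

lemma complex_integral_add:
  assumes "\<And>c. c \<in> quarter_turns \<Longrightarrow> integrable (part c) f"
    and "\<And>c. c \<in> quarter_turns \<Longrightarrow> integrable (part c) g"
  shows "complex_integral M \<mu> (\<lambda>x. f x + g x) = complex_integral M \<mu> f + complex_integral M \<mu> g"
  using assms by (simp add: complex_integral_eq distrib_left flip: sum.distrib)

lemma complex_integral_mult:
  "complex_integral M \<mu> (\<lambda>x. a * f x) = a * complex_integral M \<mu> f"
  by (simp add: complex_integral_eq sum_distrib_left mult_ac)

text \<open>Meant for approximations that are good up to \<open>a\<close> except on a small set
  \<open>E\<close>, where only the crude additional bound \<open>b\<close> holds.\<close>

lemma norm_complex_integral_le:
  assumes f: "f \<in> borel_measurable M" and E: "E \<in> sets M" and "0 \<le> a" "0 \<le> b"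
    and le_a: "\<And>c. c \<in> quarter_turns \<Longrightarrow> AE x in part c. cmod (f x) \<le> a + indicator E x * b"
  shows "cmod (complex_integral M \<mu> f) \<le> a * mass (space M) + b * mass E"
proof -
  have "cmod (integral\<^sup>L (part c) f) \<le> a * measure (part c) (space M) + b * measure (part c) E"
    if c: "c \<in> quarter_turns" for c
  proof -
    interpret finite_measure "part c" by (rule finite_measure_part)
    have int: "integrable (part c) (\<lambda>x. a + indicator E x * b)"
      using E by (intro integrable_const_bound[where B="a+b"]) (auto simp: indicator_def \<open>0 \<le> a\<close> \<open>0 \<le> b\<close>)
    have "cmod (integral\<^sup>L (part c) f) \<le> (\<integral>x. cmod (f x) \<partial>part c)"
      by (rule integral_norm_bound)
    also have "\<dots> \<le> (\<integral>x. a + indicator E x * b \<partial>part c)"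
    proof (intro integral_mono_AE integrable_norm Bochner_Integration.integrable_bound[OF int])
      show "AE x in part c. cmod (f x) \<le> norm (a + indicator E x * b)"
        using le_a[OF c] by (rule eventually_mono) (use \<open>0 \<le> a\<close> \<open>0 \<le> b\<close> in auto)
    qed (use int f le_a[OF c] in auto)
    also have "\<dots> = a * measure (part c) (space M) + b * measure (part c) E"
      using E sets.sets_into_space[of E M]
      by (subst Bochner_Integration.integral_add)
        (auto simp: space_part Int_absorb2 sets_part less_top[symmetric] intro!: integrable_real_indicator)
    finally show ?thesis .
  qed
  then have "cmod (complex_integral M \<mu> f) \<le> 
     (\<Sum>c\<in>quarter_turns. a * measure (part c) (space M) + b * measure (part c) E)"
    unfolding complex_integral_eq
    by (intro order_trans[OF norm_sum] sum_mono) (simp add: norm_mult cmod_quarter_turn)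
  then show ?thesis by (simp add: mass_def sum.distrib sum_distrib_left)
qed

text \<open>Every partition of \<open>C\<close> becomes one of \<open>E\<close> after adding the two
  pieces \<open>A\<close> and \<open>E - C - A\<close>; the contribution of the latter is
  discarded.\<close>

lemma total_variation_add_le:
  assumes "C \<in> sets M" "A \<in> sets M" "E \<in> sets M" "C \<subseteq> E" "A \<subseteq> E - C"
  shows "total_variation M \<mu> C + ennreal (cmod (\<mu> A)) \<le> total_variation M \<mu> E"
proof -
  have "(\<lambda>n::nat. if n = 0 then C else {}) \<in> {F. range F \<subseteq> sets M \<and> disjoint_family F \<and> (\<Union>n. F n) = C}"
    using assms(1) by (auto simp: disjoint_family_on_def)
  then have ne: "{F :: nat \<Rightarrow> 'b set. range F \<subseteq> sets M \<and> disjoint_family F \<and> (\<Union>n. F n) = C} \<noteq> {}"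
    by blast
  show ?thesis
    unfolding total_variation_def[of M \<mu> C]
  proof (subst ennreal_SUP_add_left[symmetric, OF ne], rule SUP_least)
    fix F :: "nat \<Rightarrow> 'b set"
    assume "F \<in> {F. range F \<subseteq> sets M \<and> disjoint_family F \<and> (\<Union>n. F n) = C}"
    then have F: "range F \<subseteq> sets M" "disjoint_family F" "(\<Union>n. F n) = C" by auto
    define G where "G n = (case n of 0 \<Rightarrow> A | Suc 0 \<Rightarrow> E - C - A | Suc (Suc n) \<Rightarrow> F n)" for n
    have G: "G 0 = A" "G (Suc 0) = E - C - A" "G (Suc (Suc n)) = F n" for n
      by (simp_all add: G_def)
    have F_sub: "F n \<subseteq> C" for n using F(3) by blast
    have G_sets: "G n \<in> sets M" for n
      using assms F(1) by (cases n; cases "n - 1") (auto simp: G_def)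
    have "G m \<inter> G n = {}" if "m < n" for m n :: nat
    proof (cases m)
      case 0
      have "G n \<subseteq> E - A" if n: "n = Suc n'" for n'
        using assms F_sub[of "n' - 1"] n by (cases n') (auto simp: G)
      then show ?thesis using 0 \<open>m < n\<close> by (cases n) (auto simp: G(1))
    next
      case (Suc m')
      then obtain n' where n': "n = Suc (Suc n')" 
        using \<open>m < n\<close> by (cases n; cases "n - 1") auto
      show ?thesis
      proof (cases m')
        case 0
        then show ?thesis using Suc n' F_sub[of n'] by (auto simp: G)
      next
        case (Suc m'')
        then have "F m'' \<inter> F n' = {}"
          using F(2) \<open>m = Suc m'\<close> n' that by (auto simp: disjoint_family_on_def)
        then show ?thesis using \<open>m = Suc m'\<close> Suc n' by (simp add: G)
      qed
    qed
    then have "disjoint_family G"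
      unfolding disjoint_family_on_def by (metis Int_commute nat_neq_iff)
    moreover have "(\<Union>n. G n) = E"
    proof -
      have "G n \<subseteq> E" for n
        using assms F_sub[of "n - 2"] by (cases n; cases "n - 1") (auto simp: G_def)
      moreover have "E \<subseteq> G 0 \<union> G (Suc 0) \<union> (\<Union>n. G (Suc (Suc n)))"
        using F(3) by (auto simp: G)
      ultimately show ?thesis by blast
    qed
    moreover have "range G \<subseteq> sets M" using G_sets by blast
    ultimately have "G \<in> {F. range F \<subseteq> sets M \<and> disjoint_family F \<and> (\<Union>n. F n) = E}"
      by blast
    then have "(\<Sum>n. ennreal (cmod (\<mu> (G n)))) \<le> total_variation M \<mu> E"
      unfolding total_variation_def by (rule SUP_upper)
    moreover have "(\<Sum>n. ennreal (cmod (\<mu> (G n)))) =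
        (\<Sum>n. ennreal (cmod (\<mu> (F n)))) + (ennreal (cmod (\<mu> A)) + ennreal (cmod (\<mu> (E - C - A))))"
      by (subst suminf_offset[where i = "Suc (Suc 0)"]) (simp_all add: G(1,2) G(3)[unfolded One_nat_def] lessThan_Suc add_ac)
    ultimately have "(\<Sum>n. ennreal (cmod (\<mu> (F n)))) + ennreal (cmod (\<mu> A)) + ennreal (cmod (\<mu> (E - C - A)))
        \<le> total_variation M \<mu> E"
      by (simp only: add.assoc)
    then show "(\<Sum>n. ennreal (cmod (\<mu> (F n)))) + ennreal (cmod (\<mu> A)) \<le> total_variation M \<mu> E"
      by (rule order_trans[rotated]) simp
  qed
qed

text \<open>On a partition \<open>cmod \<mu>\<close> is dominated by \<open>mass\<close>, which sums
  up because each \<open>part c\<close> is a measure. In particular the total variation is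
  finite.\<close>

lemma total_variation_le_mass:
  assumes "E \<in> sets M"
  shows "total_variation M \<mu> E \<le> ennreal (mass E)"
  unfolding total_variation_def
proof (rule SUP_least)
  fix F :: "nat \<Rightarrow> 'b set"
  assume "F \<in> {F. range F \<subseteq> sets M \<and> disjoint_family F \<and> (\<Union>n. F n) = E}"
  then have F: "range F \<subseteq> sets M" "disjoint_family F" "(\<Union>n. F n) = E" by auto
  have mass: "ennreal (mass X) = (\<Sum>c\<in>quarter_turns. emeasure (part c) X)" for X
    by (simp add: mass_def finite_measure.emeasure_eq_measure[OF finite_measure_part] flip: sum_ennreal)
  have "(\<Sum>n. ennreal (cmod (\<mu> (F n)))) \<le> (\<Sum>n. ennreal (mass (F n)))"
    using F(1) by (intro suminf_le ennreal_leI cmod_le_mass) auto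
  also have "\<dots> = (\<Sum>c\<in>quarter_turns. \<Sum>n. emeasure (part c) (F n))"
    unfolding mass by (rule suminf_sum) auto
  also have "\<dots> = (\<Sum>c\<in>quarter_turns. emeasure (part c) E)"
    using F by (intro sum.cong refl) (simp add: suminf_emeasure sets_part)
  finally show "(\<Sum>n. ennreal (cmod (\<mu> (F n)))) \<le> ennreal (mass E)"
    by (simp add: mass)
qed

text \<open>Translates inner regularity, a statement about total variations, into smallness of
  \<open>mass\<close> on the remainder. Finiteness allows \<open>total_variation M \<mu> C\<close>
  to be cancelled.\<close>

lemma mass_le_total_variation:
  assumes "C \<in> sets M" "E \<in> sets M" "C \<subseteq> E" "0 \<le> b"
    and "total_variation M \<mu> E \<le> total_variation M \<mu> C + ennreal b"
  shows "mass (E - C) \<le> 4 * b"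
proof (rule mass_le)
  fix A assume A: "A \<in> sets M" "A \<subseteq> E - C"
  have fin: "total_variation M \<mu> C \<noteq> top"
    using total_variation_le_mass[OF assms(1)] by (auto simp: top_unique)
  have "total_variation M \<mu> C + ennreal (cmod (\<mu> A)) \<le> total_variation M \<mu> C + ennreal b"
    using total_variation_add_le[OF assms(1) A(1) assms(2,3) A(2)] assms(5) by (rule order_trans)
  then show "cmod (\<mu> A) \<le> b"
    using fin \<open>0 \<le> b\<close> by (simp add: ennreal_add_left_cancel_le ennreal_le_iff)
qed (use assms in auto)

end

section \<open>Factorizing functionals\<close>

text \<open>The complex linear span, built by one scaled generator at a time, so that a linear
  identity needs a single induction step over generators.\<close>

inductive_set cspan :: "('a \<Rightarrow> complex) set \<Rightarrow> ('a \<Rightarrow> complex) set" for B where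
  zero: "(\<lambda>_. 0) \<in> cspan B"
| step: "b \<in> B \<Longrightarrow> f \<in> cspan B \<Longrightarrow> (\<lambda>x. c * b x + f x) \<in> cspan B"

lemma cspan_base: "b \<in> B \<Longrightarrow> b \<in> cspan B"
  using cspan.step[OF _ cspan.zero, of b B 1] by simp

lemma cspan_add:
  assumes "f \<in> cspan B" "g \<in> cspan B"
  shows "(\<lambda>x. f x + g x) \<in> cspan B"
  using assms by (induction rule: cspan.induct) (auto simp: add.assoc intro: cspan.step)

lemma cspan_scale:
  assumes "f \<in> cspan B"
  shows "(\<lambda>x. a * f x) \<in> cspan B"
  using assms
proof (induction rule: cspan.induct)
  case (step b f c)
  then show ?case using cspan.step[of b B "\<lambda>x. a * f x" "a * c"] by (simp add: algebra_simps)
qed (simp add: cspan.zero)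

lemma cspan_diff:
  assumes "f \<in> cspan B" "g \<in> cspan B"
  shows "(\<lambda>x. f x - g x) \<in> cspan B"
  using cspan_add[OF assms(1) cspan_scale[OF assms(2), of "-1"]] by simp

lemma cspan_sum:
  assumes "\<And>i. i \<in> I \<Longrightarrow> f i \<in> cspan B"
  shows "(\<lambda>x. \<Sum>i\<in>I. f i x) \<in> cspan B"
  using assms by (induction I rule: infinite_finite_induct) (auto intro: cspan.zero cspan_add)

lemma cspan_subset:
  assumes "f \<in> cspan B" "(\<lambda>_. 0) \<in> X"
    and "\<And>b. b \<in> B \<Longrightarrow> b \<in> X"
    and "\<And>f g. f \<in> X \<Longrightarrow> g \<in> X \<Longrightarrow> (\<lambda>x. f x + g x) \<in> X"
    and "\<And>f a. f \<in> X \<Longrightarrow> (\<lambda>x. a * f x) \<in> X"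
  shows "f \<in> X"
  using assms(1)
proof (induction rule: cspan.induct)
  case (step b f c)
  show ?case by (rule assms(4)[OF assms(5)[OF assms(3)[OF step.hyps(1)]] step.IH])
qed (rule assms(2))

text \<open>The weight \<open>\<phi>\<close> and the substitution \<open>\<pi>\<close> serve two
  purposes: multiplication by a fixed function (\<open>\<pi>\<close> the identity) and lifting to
  two variables (\<open>\<pi>\<close> a projection).\<close>

lemma cspan_image:
  assumes "f \<in> cspan B" "\<And>b. b \<in> B \<Longrightarrow> (\<lambda>x. \<phi> x * b (\<pi> x)) \<in> cspan B'"
  shows "(\<lambda>x. \<phi> x * f (\<pi> x)) \<in> cspan B'"
  using assms(1)
proof (induction rule: cspan.induct)
  case (step b f c)
  then show ?case
    using cspan_add[OF cspan_scale[OF assms(2), of b c] step.IH] by (simp add: algebra_simps)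
qed (simp add: cspan.zero)

lemma cspan_mult:
  assumes "\<And>b b'. b \<in> B \<Longrightarrow> b' \<in> B \<Longrightarrow> (\<lambda>x. b x * b' x) \<in> B"
    and f: "f \<in> cspan B" and g: "g \<in> cspan B"
  shows "(\<lambda>x. f x * g x) \<in> cspan B"
proof (rule cspan_image[OF g])
  fix b assume b: "b \<in> B"
  show "(\<lambda>x. f x * b x) \<in> cspan B"
    using cspan_image[OF f, where \<phi> = b and \<pi> = "\<lambda>x. x" and B' = B] assms(1) b
    by (simp add: mult.commute cspan_base)
qed

text \<open>Exponents start at 1, as the span need not contain the constant function 1.\<close>

lemma cspan_power:
  assumes "\<And>b b'. b \<in> B \<Longrightarrow> b' \<in> B \<Longrightarrow> (\<lambda>x. b x * b' x) \<in> B" and "f \<in> cspan B"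
  shows "(\<lambda>x. f x ^ Suc n) \<in> cspan B"
proof (induction n)
  case (Suc n)
  have "(\<lambda>x. f x * f x ^ Suc n) \<in> cspan B"
    by (rule cspan_mult[OF assms(1) assms(2) Suc])
  then show ?case by simp
qed (simp add: assms(2))

lemma cspan_cnj:
  assumes "f \<in> cspan B" "\<And>b. b \<in> B \<Longrightarrow> (\<lambda>x. cnj (b x)) \<in> cspan B'"
  shows "(\<lambda>x. cnj (f x)) \<in> cspan B'"
  using assms(1)
proof (induction rule: cspan.induct)
  case (step b f c)
  then show ?case
    using cspan_add[OF cspan_scale[OF assms(2), of b "cnj c"] step.IH] by simp
qed (simp add: cspan.zero)

text \<open>Keeps of the measure only a linear functional bounded by the supremum norm on
  \<open>K\<close>. The axioms survive replacing \<open>e\<close> by its conjugate.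
  \<open>e 1\<close> is a multiplicative idempotent and not the constant 1, so it stands in for the
  unit below.\<close>

locale moment_functional =
  fixes G :: "('a::topological_space \<Rightarrow> complex) set" and L :: "('a \<Rightarrow> complex) \<Rightarrow> complex"
    and K :: "'a set" and C :: real and e :: "'s::comm_monoid_mult \<Rightarrow> 'a \<Rightarrow> complex"
  assumes G_add: "f \<in> G \<Longrightarrow> g \<in> G \<Longrightarrow> (\<lambda>x. f x + g x) \<in> G"
    and G_scale: "f \<in> G \<Longrightarrow> (\<lambda>x. a * f x) \<in> G"
    and G_mult: "f \<in> G \<Longrightarrow> g \<in> G \<Longrightarrow> (\<lambda>x. f x * g x) \<in> G"
    and G_bounded: "f \<in> G \<Longrightarrow> \<exists>b. \<forall>x\<in>K. cmod (f x) \<le> b"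
    and L_add: "f \<in> G \<Longrightarrow> g \<in> G \<Longrightarrow> L (\<lambda>x. f x + g x) = L f + L g"
    and L_scale: "f \<in> G \<Longrightarrow> L (\<lambda>x. a * f x) = a * L f"
    and L_bound: "f \<in> G \<Longrightarrow> 0 \<le> b \<Longrightarrow> (\<And>x. x \<in> K \<Longrightarrow> cmod (f x) \<le> b) \<Longrightarrow> cmod (L f) \<le> C * b"
    and C_nonneg: "0 \<le> C"
    and e_G: "e s \<in> G" and cnj_e_G: "(\<lambda>x. cnj (e s x)) \<in> G"
    and e_mult: "e (s * t) x = e s x * e t x"
    and L_e_1: "L (e 1) = 1"
    and L_factor: "L (\<lambda>x. e s x * cnj (e t x)) = L (e s) * L (\<lambda>x. cnj (e t x))"
begin

lemma G_zero: "(\<lambda>_. 0) \<in> G"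
  using G_scale[OF e_G[of 1], of 0] by simp

lemma L_zero: "L (\<lambda>_. 0) = 0"
  using L_scale[OF e_G[of 1], of 0] by simp

lemma cnj_e_1: "cnj (e 1 x) = e 1 x"
proof -
  have "e 1 x * e 1 x = e 1 x" using e_mult[of 1 1 x] by simp
  then have "e 1 x = 0 \<or> e 1 x = 1" by auto
  then show ?thesis by auto
qed

text \<open>An iterated functional in place of a product measure: it is only applied to finite sums
  of tensors, where exchanging the variables is pure algebra.\<close>

definition LL :: "('a \<times> 'a \<Rightarrow> complex) \<Rightarrow> complex" where
  "LL F = L (\<lambda>x. L (\<lambda>y. F (x, y)))"

definition tensors :: "('a \<times> 'a \<Rightarrow> complex) set" where
  "tensors = {\<lambda>z. a (fst z) * b (snd z) | a b. a \<in> G \<and> b \<in> G}"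

definition monomials2 :: "('a \<times> 'a \<Rightarrow> complex) set" where
  "monomials2 = {\<lambda>z. e s (fst z) * e t (snd z) | s t. True}"

text \<open>Exactly the membership in \<open>G\<close> that linearity needs at the inner and at the
  outer application of \<open>L\<close>.\<close>

definition integrable2 :: "('a \<times> 'a \<Rightarrow> complex) set" where
  "integrable2 = {F. (\<forall>x. (\<lambda>y. F (x, y)) \<in> G) \<and> (\<lambda>x. L (\<lambda>y. F (x, y))) \<in> G}"

lemma tensorsI: "a \<in> G \<Longrightarrow> b \<in> G \<Longrightarrow> (\<lambda>z. a (fst z) * b (snd z)) \<in> tensors"
  unfolding tensors_def by blast

lemma tensors_mult: "F \<in> tensors \<Longrightarrow> H \<in> tensors \<Longrightarrow> (\<lambda>z. F z * H z) \<in> tensors"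
proof -
  assume "F \<in> tensors" "H \<in> tensors"
  then obtain a b a' b' where *: "a \<in> G" "b \<in> G" "a' \<in> G" "b' \<in> G"
    "F = (\<lambda>z. a (fst z) * b (snd z))" "H = (\<lambda>z. a' (fst z) * b' (snd z))"
    unfolding tensors_def by blast
  have eq: "(\<lambda>z. F z * H z) = (\<lambda>z. (a (fst z) * a' (fst z)) * (b (snd z) * b' (snd z)))"
    using * by (simp add: mult_ac)
  show ?thesis unfolding eq using tensorsI[OF G_mult[OF *(1,3)] G_mult[OF *(2,4)]] .
qed

lemma monomials2_mult: "F \<in> monomials2 \<Longrightarrow> H \<in> monomials2 \<Longrightarrow> (\<lambda>z. F z * H z) \<in> monomials2"
proof -
  assume "F \<in> monomials2" "H \<in> monomials2"
  then obtain a b a' b' where *: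
    "F = (\<lambda>z. e a (fst z) * e b (snd z))" "H = (\<lambda>z. e a' (fst z) * e b' (snd z))"
    unfolding monomials2_def by blast
  have "(\<lambda>z. F z * H z) = (\<lambda>z. e (a * a') (fst z) * e (b * b') (snd z))"
    using * by (simp add: e_mult mult_ac)
  then show ?thesis unfolding monomials2_def by blast
qed

lemma integrable2_add: "F \<in> integrable2 \<Longrightarrow> H \<in> integrable2 \<Longrightarrow> (\<lambda>z. F z + H z) \<in> integrable2"
  and LL_add: "F \<in> integrable2 \<Longrightarrow> H \<in> integrable2 \<Longrightarrow> LL (\<lambda>z. F z + H z) = LL F + LL H"
  unfolding integrable2_def LL_def by (auto simp: L_add G_add)

lemma integrable2_scale: "F \<in> integrable2 \<Longrightarrow> (\<lambda>z. a * F z) \<in> integrable2"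
  and LL_scale: "F \<in> integrable2 \<Longrightarrow> LL (\<lambda>z. a * F z) = a * LL F"
  unfolding integrable2_def LL_def by (auto simp: L_scale G_scale)

lemma
  assumes "a \<in> G" "b \<in> G"
  shows tensor_integrable2: "(\<lambda>z. a (fst z) * b (snd z)) \<in> integrable2"
    and LL_tensor: "LL (\<lambda>z. a (fst z) * b (snd z)) = L a * L b"
  using assms G_scale[OF assms(1), of "L b"] L_scale[OF assms(1), of "L b"]
  by (auto simp: integrable2_def LL_def L_scale G_scale mult.commute)

lemma tensors_integrable2: "F \<in> cspan tensors \<Longrightarrow> F \<in> integrable2"
proof (erule cspan_subset)
  show "(\<lambda>_. 0) \<in> integrable2"
    using integrable2_scale[OF tensor_integrable2[OF e_G e_G], of 0] by simp
qed (auto simp: tensors_def intro: integrable2_add integrable2_scale tensor_integrable2)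

lemma LL_zero: "LL (\<lambda>_. 0) = 0"
  by (simp add: LL_def L_zero)

lemma LL_sum:
  assumes "\<And>i. i \<in> I \<Longrightarrow> F i \<in> cspan tensors"
  shows "LL (\<lambda>z. \<Sum>i\<in>I. F i z) = (\<Sum>i\<in>I. LL (F i))"
  using assms
  by (induction I rule: infinite_finite_induct)
    (auto simp: LL_zero LL_add tensors_integrable2 cspan_sum)

lemma LL_bound:
  assumes "F \<in> cspan tensors" "0 \<le> b" "\<And>x y. x \<in> K \<Longrightarrow> y \<in> K \<Longrightarrow> cmod (F (x, y)) \<le> b"
  shows "cmod (LL F) \<le> C * (C * b)"
  unfolding LL_def using tensors_integrable2[OF assms(1)] assms(2,3) C_nonneg
  by (intro L_bound) (auto simp: integrable2_def)

text \<open>Fubini for tensors: \<open>L a * L b\<close> is symmetric. Membership is proved along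
  with the equation because the induction step needs it.\<close>

lemma LL_swap:
  assumes "F \<in> cspan tensors"
  shows "(\<lambda>z. F (prod.swap z)) \<in> cspan tensors \<and> LL (\<lambda>z. F (prod.swap z)) = LL F"
  using assms
proof (induction rule: cspan.induct)
  case (step B F c)
  then obtain a b where ab: "a \<in> G" "b \<in> G" and B: "B = (\<lambda>z. a (fst z) * b (snd z))"
    unfolding tensors_def by blast
  have swapB: "(\<lambda>z. B (prod.swap z)) = (\<lambda>z. b (fst z) * a (snd z))"
    by (simp add: B mult.commute)
  then have in_tensors: "(\<lambda>z. B (prod.swap z)) \<in> tensors"
    using ab unfolding tensors_def by blast
  have "LL (\<lambda>z. B (prod.swap z)) = LL B"
    unfolding swapB unfolding B LL_tensor[OF ab] LL_tensor[OF ab(2,1)] by (rule mult.commute)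
  moreover have "LL (\<lambda>z. c * B' z + F' z) = c * LL B' + LL F'"
    if "B' \<in> tensors" "F' \<in> cspan tensors" for B' F'
    using that LL_add[of "\<lambda>z. c * B' z" F'] LL_scale[of B' c]
    by (simp add: tensors_integrable2 cspan_base cspan_scale)
  ultimately show ?case
    using step in_tensors cspan.step[OF in_tensors] by simp
qed (simp add: cspan.zero)

text \<open>Invariance under the swap gives \<open>LL F = - LL F\<close>.\<close>

lemma LL_antisymmetric:
  assumes "F \<in> cspan tensors" "\<And>z. F (prod.swap z) = - F z"
  shows "LL F = 0"
  using LL_swap[OF assms(1)] LL_scale[OF tensors_integrable2[OF assms(1)], of "-1"] assms(2)
  by simp

lemma polynomials2_tensors:
  assumes "F \<in> cspan monomials2"
  shows "F \<in> cspan tensors" and "(\<lambda>z. cnj (F z)) \<in> cspan tensors"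
proof -
  have "B \<in> tensors \<and> (\<lambda>z. cnj (B z)) \<in> tensors" if B: "B \<in> monomials2" for B
  proof -
    obtain s t where "B = (\<lambda>z. e s (fst z) * e t (snd z))" using B unfolding monomials2_def by blast
    then show ?thesis
      using tensorsI[OF e_G e_G, of s t] tensorsI[OF cnj_e_G cnj_e_G, of s t] by simp
  qed
  then show "F \<in> cspan tensors" "(\<lambda>z. cnj (F z)) \<in> cspan tensors"
    using cspan_image[OF assms, of "\<lambda>_. 1" "\<lambda>z. z" tensors] cspan_cnj[OF assms, of tensors]
    by (simp_all add: cspan_base)
qed

text \<open>Both sides are linear in \<open>F\<close> and conjugate-linear in \<open>H\<close>, so
  monomials suffice; there \<open>L_factor\<close> applies in each variable separately.\<close>

lemma LL_factor:
  assumes "F \<in> cspan monomials2" "H \<in> cspan monomials2"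
  shows "LL (\<lambda>z. F z * cnj (H z)) = LL F * LL (\<lambda>z. cnj (H z))"
proof -
  have T: "(\<lambda>z. F z * cnj (H z)) \<in> cspan tensors"
    if "F \<in> cspan monomials2" "H \<in> cspan monomials2" for F H
    using that by (intro cspan_mult tensors_mult polynomials2_tensors)
  note int = tensors_integrable2[OF T] tensors_integrable2[OF polynomials2_tensors(1)]
    tensors_integrable2[OF polynomials2_tensors(2)]
  have base: "LL (\<lambda>z. B z * cnj (B' z)) = LL B * LL (\<lambda>z. cnj (B' z))"
    if B: "B \<in> monomials2" "B' \<in> monomials2" for B B'
  proof -
    obtain s t s' t' where *: "B = (\<lambda>z. e s (fst z) * e t (snd z))" "B' = (\<lambda>z. e s' (fst z) * e t' (snd z))"
      using B unfolding monomials2_def by blast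
    have "LL (\<lambda>z. B z * cnj (B' z)) =
        LL (\<lambda>z. (\<lambda>x. e s x * cnj (e s' x)) (fst z) * (\<lambda>x. e t x * cnj (e t' x)) (snd z))"
      by (simp add: * mult_ac)
    also have "\<dots> = L (e s) * L (e t) * (L (\<lambda>x. cnj (e s' x)) * L (\<lambda>x. cnj (e t' x)))"
      by (subst LL_tensor) (simp_all add: G_mult e_G cnj_e_G L_factor)
    also have "L (e s) * L (e t) = LL B"
      unfolding * by (simp add: LL_tensor e_G)
    also have "L (\<lambda>x. cnj (e s' x)) * L (\<lambda>x. cnj (e t' x)) = LL (\<lambda>z. cnj (B' z))"
      using LL_tensor[OF cnj_e_G cnj_e_G] by (simp add: *)
    finally show ?thesis .
  qed
  have left: "LL (\<lambda>z. B z * cnj (H z)) = LL B * LL (\<lambda>z. cnj (H z))" if B: "B \<in> monomials2" for B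
    using assms(2)
  proof (induction rule: cspan.induct)
    case (step B' H c)
    have "LL (\<lambda>z. B z * cnj (c * B' z + H z)) = LL (\<lambda>z. cnj c * (B z * cnj (B' z)) + B z * cnj (H z))"
      by (simp add: algebra_simps)
    also have "\<dots> = cnj c * LL (\<lambda>z. B z * cnj (B' z)) + LL (\<lambda>z. B z * cnj (H z))"
      using step B by (simp add: LL_add LL_scale integrable2_scale int cspan_base)
    also have "\<dots> = LL B * (cnj c * LL (\<lambda>z. cnj (B' z)) + LL (\<lambda>z. cnj (H z)))"
      using step B by (simp add: base algebra_simps)
    also have "cnj c * LL (\<lambda>z. cnj (B' z)) + LL (\<lambda>z. cnj (H z)) = LL (\<lambda>z. cnj (c * B' z + H z))"
      using step by (simp add: LL_add LL_scale integrable2_scale int cspan_base)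
    finally show ?case .
  qed (simp add: LL_zero)
  show ?thesis
    using assms(1)
  proof (induction rule: cspan.induct)
    case (step B F c)
    have "LL (\<lambda>z. (c * B z + F z) * cnj (H z)) = LL (\<lambda>z. c * (B z * cnj (H z)) + F z * cnj (H z))"
      by (simp add: algebra_simps)
    also have "\<dots> = c * LL (\<lambda>z. B z * cnj (H z)) + LL (\<lambda>z. F z * cnj (H z))"
      using step assms(2) by (simp add: LL_add LL_scale integrable2_scale int cspan_base)
    also have "\<dots> = (c * LL B + LL F) * LL (\<lambda>z. cnj (H z))"
      using step by (simp add: left algebra_simps)
    also have "c * LL B + LL F = LL (\<lambda>z. c * B z + F z)"
      using step by (simp add: LL_add LL_scale integrable2_scale int cspan_base)
    finally show ?case .
  qed (simp add: LL_zero)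
qed

end

lemma cspan_functional_mult:
  fixes L :: "('a \<Rightarrow> complex) \<Rightarrow> complex"
  assumes zero: "L (\<lambda>_. 0) = 0"
    and add: "\<And>f g. f \<in> cspan B \<Longrightarrow> g \<in> cspan B \<Longrightarrow> L (\<lambda>x. f x + g x) = L f + L g"
    and scale: "\<And>f a. f \<in> cspan B \<Longrightarrow> L (\<lambda>x. a * f x) = a * L f"
    and mult: "\<And>b b'. b \<in> B \<Longrightarrow> b' \<in> B \<Longrightarrow> (\<lambda>x. b x * b' x) \<in> B"
    and base: "\<And>b b'. b \<in> B \<Longrightarrow> b' \<in> B \<Longrightarrow> L (\<lambda>x. b x * b' x) = L b * L b'"
    and f: "f \<in> cspan B" and g: "g \<in> cspan B"
  shows "L (\<lambda>x. f x * g x) = L f * L g"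
proof -
  have prod: "(\<lambda>x. u x * v x) \<in> cspan B" if "u \<in> cspan B" "v \<in> cspan B" for u v
    using mult that by (rule cspan_mult)
  have left: "L (\<lambda>x. b x * g x) = L b * L g" if b: "b \<in> B" for b
    using g
  proof (induction rule: cspan.induct)
    case (step b' g c)
    have "L (\<lambda>x. b x * (c * b' x + g x)) = L (\<lambda>x. c * (b x * b' x) + b x * g x)"
      by (simp add: algebra_simps)
    also have "\<dots> = c * L (\<lambda>x. b x * b' x) + L (\<lambda>x. b x * g x)"
      using step b by (simp add: add scale cspan_scale prod cspan_base)
    also have "\<dots> = L b * (c * L b' + L g)"
      using step b by (simp add: base algebra_simps)
    also have "c * L b' + L g = L (\<lambda>x. c * b' x + g x)"
      using step by (simp add: add scale cspan_scale cspan_base)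
    finally show ?case .
  qed (simp add: zero)
  show ?thesis
    using f
  proof (induction rule: cspan.induct)
    case (step b f c)
    have "L (\<lambda>x. (c * b x + f x) * g x) = L (\<lambda>x. c * (b x * g x) + f x * g x)"
      by (simp add: algebra_simps)
    also have "\<dots> = c * L (\<lambda>x. b x * g x) + L (\<lambda>x. f x * g x)"
      using step g by (simp add: add scale cspan_scale prod cspan_base)
    also have "\<dots> = (c * L b + L f) * L g"
      using step by (simp add: left algebra_simps)
    also have "c * L b + L f = L (\<lambda>x. c * b x + f x)"
      using step by (simp add: add scale cspan_scale cspan_base)
    finally show ?case .
  qed (simp add: zero)
qed

lemma sqrt_approximation:
  fixes m \<epsilon> :: real
  assumes "0 < \<epsilon>"
  obtains a :: "nat \<Rightarrow> real" and n where
    "\<And>u. 0 \<le> u \<Longrightarrow> u \<le> m \<Longrightarrow> \<bar>u - (\<Sum>i<n. a i * u ^ (2 * i + 2))\<bar> < \<epsilon>"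
proof -
  have "continuous_on {0..m\<^sup>2} sqrt"
    using continuous_on_real_sqrt[OF continuous_on_id] by simp
  then obtain g where g: "real_polynomial_function g"
    and approx: "\<And>v. v \<in> {0..m\<^sup>2} \<Longrightarrow> \<bar>sqrt v - g v\<bar> < \<epsilon> / 2"
    using Stone_Weierstrass_real_polynomial_function[OF compact_Icc _ half_gt_zero[OF \<open>0 < \<epsilon>\<close>]]
    by blast
  obtain a n where a: "g = (\<lambda>v. \<Sum>i\<le>n. a i * v ^ i)"
    using g real_polynomial_function_iff_sum[of g] by blast
  show thesis
  proof (rule that[where a = "\<lambda>i. a (Suc i)" and n = n])
    fix u :: real
    assume u: "0 \<le> u" "u \<le> m"
    have "\<bar>u - g (u\<^sup>2)\<bar> < \<epsilon> / 2"
      using approx[of "u\<^sup>2"] u by (simp add: power_mono)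
    moreover have "g (u\<^sup>2) = a 0 + (\<Sum>i<n. a (Suc i) * u ^ (2 * i + 2))"
      unfolding a by (simp add: sum.atMost_shift flip: power_mult)
    moreover have "\<bar>a 0\<bar> < \<epsilon> / 2"
      using approx[of 0] by (simp add: a sum.atMost_shift)
    ultimately show "\<bar>u - (\<Sum>i<n. a (Suc i) * u ^ (2 * i + 2))\<bar> < \<epsilon>"
      by linarith
  qed
qed

section \<open>Multiplicativity on holomorphic polynomials\<close>

context moment_functional
begin

lemma polynomials_G:
  assumes "f \<in> cspan (range e)"
  shows "f \<in> G"
  using assms by (rule cspan_subset) (auto intro: G_add G_scale G_zero e_G)

lemma e_1_neutral:
  assumes "f \<in> cspan (range e)"
  shows "f x * e 1 x = f x"
  using assms
proof (induction rule: cspan.induct)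
  case (step b f c)
  then obtain s where "b = e s" by blast
  then have "b x * e 1 x = b x" using e_mult[of s 1 x] by simp
  then show ?case using step.IH by (simp only: distrib_right mult.assoc)
qed simp

lemma e_1_idem: "e 1 x * e 1 x = e 1 x"
  using e_mult[of 1 1 x] by simp

text \<open>With \<open>p(x, y) = f(x) - f(y)\<close> and \<open>u = p * cnj p\<close>, odd powers \<open>k\<close> make both factors of
  \<open>p\<^sup>2 * u^k = p^(k + 2) * cnj (p^k)\<close> antisymmetric, so \<open>LL\<close> kills it; and \<open>p\<^sup>2\<close> itself is a uniform
  limit of linear combinations of these functions by polynomial approximation of the square root.\<close>

lemma L_square:
  assumes f: "f \<in> cspan (range e)"
  shows "L (\<lambda>x. f x * f x) = L f * L f"
proof -
  \<comment> \<open>The factors \<open>e 1\<close> replace the constant 1, so that \<open>p\<close>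
    is a combination of products of one \<open>e s\<close> in each variable.\<close>
  define p where "p z = f (fst z) * e 1 (snd z) - e 1 (fst z) * f (snd z)" for z
  have ff: "(\<lambda>x. f x * f x) \<in> G"
    using polynomials_G[OF f] by (intro G_mult)
  have p: "p \<in> cspan monomials2"
  proof -
    have m2: "(\<lambda>z. e s (fst z) * e t (snd z)) \<in> cspan monomials2" for s t
      by (rule cspan_base) (auto simp: monomials2_def)
    have "(\<lambda>z. e 1 (snd z) * f (fst z)) \<in> cspan monomials2"
      using cspan_image[OF f, of "\<lambda>z. e 1 (snd z)" fst monomials2] m2 by (auto simp: mult.commute)
    moreover have "(\<lambda>z. e 1 (fst z) * f (snd z)) \<in> cspan monomials2"
      using cspan_image[OF f, of "\<lambda>z. e 1 (fst z)" snd monomials2] m2 by auto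
    ultimately show ?thesis
      unfolding p_def[abs_def] using cspan_diff by (fastforce simp: mult.commute)
  qed
  have p_power: "(\<lambda>z. p z ^ Suc n) \<in> cspan monomials2" for n
    using monomials2_mult p by (rule cspan_power)
  have p_swap: "p (prod.swap z) = - p z" for z
    by (simp add: p_def mult.commute)
  have pp: "(\<lambda>z. p z ^ 2) \<in> cspan tensors"
    using polynomials2_tensors(1)[OF p_power[of 1]] by (simp add: numeral_2_eq_2)
  obtain b where b: "\<And>x. x \<in> K \<Longrightarrow> cmod (f x) \<le> b"
    using G_bounded[OF polynomials_G[OF f]] by blast
  define m where "m = (b * 1 + 1 * b)\<^sup>2"
  have p_le: "cmod (p (x, y)) ^ 2 \<le> m" if "x \<in> K" "y \<in> K" for x y
  proof -
    have one: "cmod (e 1 z) \<le> 1" for z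
      using e_1_idem[of z] by auto
    have "cmod (p (x, y)) \<le> cmod (f x) * cmod (e 1 y) + cmod (e 1 x) * cmod (f y)"
      unfolding p_def fst_conv snd_conv norm_mult[symmetric] by (rule norm_triangle_ineq4)
    also have "\<dots> \<le> b * 1 + 1 * b"
      using b[OF that(1)] b[OF that(2)] one order_trans[OF norm_ge_zero b[OF that(1)]]
      by (intro add_mono mult_mono) auto
    finally show ?thesis unfolding m_def by (intro power_mono) auto
  qed
  have "cmod (LL (\<lambda>z. p z ^ 2)) \<le> C * (C * \<epsilon>)" if "0 < \<epsilon>" for \<epsilon>
  proof -
    obtain a n where a: "\<And>u. 0 \<le> u \<Longrightarrow> u \<le> m \<Longrightarrow> \<bar>u - (\<Sum>i<n. a i * u ^ (2 * i + 2))\<bar> < \<epsilon>"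
      using sqrt_approximation[OF \<open>0 < \<epsilon>\<close>] by blast
    \<comment> \<open>This is \<open>p\<^sup>2 * u^k\<close> for \<open>k = 2 * i + 1\<close>,
      written so that \<open>LL_factor\<close> applies.\<close>
    define Q where "Q i z = p z ^ Suc (2 * i + 2) * cnj (p z ^ Suc (2 * i))" for i z
    have Q: "Q i \<in> cspan tensors" for i
      unfolding Q_def[abs_def]
      by (intro cspan_mult tensors_mult polynomials2_tensors p_power)
    have "LL (Q i) = 0" for i
    proof -
      have "LL (Q i) = LL (\<lambda>z. p z ^ Suc (2 * i + 2)) * LL (\<lambda>z. cnj (p z ^ Suc (2 * i)))"
        unfolding Q_def[abs_def] by (intro LL_factor p_power)
      moreover have "LL (\<lambda>z. p z ^ Suc (2 * i + 2)) = 0"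
        by (rule LL_antisymmetric) (auto simp: p_swap polynomials2_tensors(1)[OF p_power] simp del: power_Suc)
      ultimately show ?thesis by simp
    qed
    moreover define R where "R z = (\<Sum>i<n. complex_of_real (a i) * Q i z)" for z
    have RT: "R \<in> cspan tensors"
      unfolding R_def[abs_def] by (intro cspan_sum cspan_scale Q)
    ultimately have LLR: "LL R = 0"
      unfolding R_def[abs_def] using Q
      by (subst LL_sum) (auto intro: cspan_scale simp: LL_scale tensors_integrable2)
    \<comment> \<open>Pulling out \<open>p z ^ 2\<close> leaves a real factor. As
      \<open>p z ^ 2\<close> has modulus \<open>u\<close>, the error becomes the scalar error in the
      square root approximation.\<close>
    have diff: "cmod (p z ^ 2 + - 1 * R z) = \<bar>cmod (p z) ^ 2 - (\<Sum>i<n. a i * (cmod (p z) ^ 2) ^ (2 * i + 2))\<bar>" for z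
    proof -
      have Qz: "Q i z = p z ^ 2 * complex_of_real ((cmod (p z))\<^sup>2 ^ Suc (2 * i))" for i
      proof -
        have "Q i z = p z ^ 2 * (p z * cnj (p z)) ^ Suc (2 * i)"
          unfolding Q_def power_mult_distrib complex_cnj_power
          by (simp add: power_add[symmetric] power2_eq_square mult_ac)
        then show ?thesis by (simp only: of_real_power flip: complex_norm_square)
      qed
      have "p z ^ 2 + - 1 * R z = p z ^ 2 * complex_of_real (1 - (\<Sum>i<n. a i * (cmod (p z))\<^sup>2 ^ Suc (2 * i)))"
        unfolding R_def Qz by (simp add: algebra_simps sum_distrib_left sum_negf del: power_Suc)
      then have "cmod (p z ^ 2 + - 1 * R z) = \<bar>cmod (p z) ^ 2 * (1 - (\<Sum>i<n. a i * (cmod (p z))\<^sup>2 ^ Suc (2 * i)))\<bar>"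
        by (simp only: norm_mult norm_power norm_of_real abs_mult) simp
      also have "cmod (p z) ^ 2 * (1 - (\<Sum>i<n. a i * (cmod (p z))\<^sup>2 ^ Suc (2 * i)))
         = cmod (p z) ^ 2 - (\<Sum>i<n. a i * (cmod (p z) ^ 2) ^ (2 * i + 2))"
        by (simp add: right_diff_distrib sum_distrib_left mult_ac power_add power2_eq_square)
      finally show ?thesis .
    qed
    have "cmod (LL (\<lambda>z. p z ^ 2 + - 1 * R z)) \<le> C * (C * \<epsilon>)"
    proof (rule LL_bound)
      show "cmod (p (x, y) ^ 2 + - 1 * R (x, y)) \<le> \<epsilon>" if "x \<in> K" "y \<in> K" for x y
        unfolding diff using a[OF zero_le_power2 p_le[OF that]] by (rule less_imp_le)
    qed (intro cspan_add pp cspan_scale RT less_imp_le[OF that])+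
    also have "LL (\<lambda>z. p z ^ 2 + - 1 * R z) = LL (\<lambda>z. p z ^ 2)"
      using pp RT by (simp only: LL_add LL_scale tensors_integrable2 integrable2_scale LLR) simp
    finally show ?thesis .
  qed
  then have "\<forall>\<^sub>F \<epsilon> in at_right 0. cmod (LL (\<lambda>z. p z ^ 2)) \<le> C * (C * \<epsilon>)"
    by (auto simp: eventually_at_filter)
  moreover have "((\<lambda>\<epsilon>. C * (C * \<epsilon>)) \<longlongrightarrow> C * (C * 0)) (at_right 0)"
    by (intro tendsto_intros)
  ultimately have "cmod (LL (\<lambda>z. p z ^ 2)) \<le> C * (C * 0)"
    by (intro tendsto_lowerbound) auto
  then have "LL (\<lambda>z. p z ^ 2) = 0" by simp
  \<comment> \<open>Expanding the square, with \<open>e 1\<close> idempotent and neutral, gives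
    \<open>LL (p\<^sup>2) = 2 * (L (f\<^sup>2) - (L f)\<^sup>2)\<close>.\<close>
  moreover have "p z ^ 2 = (f (fst z) * f (fst z)) * e 1 (snd z) + (- 2 * (f (fst z) * f (snd z)) + e 1 (fst z) * (f (snd z) * f (snd z)))" for z
  proof -
    have "p z ^ 2 = (f (fst z) * f (fst z)) * (e 1 (snd z) * e 1 (snd z)) - 2 * ((f (fst z) * e 1 (fst z)) * (f (snd z) * e 1 (snd z)))
       + (e 1 (fst z) * e 1 (fst z)) * (f (snd z) * f (snd z))"
      unfolding p_def power2_eq_square by (simp add: algebra_simps)
    then show ?thesis by (simp add: e_1_idem e_1_neutral[OF f])
  qed
  moreover have "LL (\<lambda>z. (f (fst z) * f (fst z)) * e 1 (snd z) + (- 2 * (f (fst z) * f (snd z)) + e 1 (fst z) * (f (snd z) * f (snd z))))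
    = L (\<lambda>x. f x * f x) - 2 * (L f * L f) + L (\<lambda>x. f x * f x)"
    using tensor_integrable2[OF ff e_G[of 1]] tensor_integrable2[OF e_G[of 1] ff]
      tensor_integrable2[OF polynomials_G[OF f] polynomials_G[OF f]]
      LL_tensor[OF ff e_G[of 1]] LL_tensor[OF e_G[of 1] ff]
      LL_tensor[OF polynomials_G[OF f] polynomials_G[OF f]]
    by (simp only: LL_add LL_scale integrable2_scale integrable2_add L_e_1) simp
  ultimately show ?thesis by simp
qed

text \<open>Polarization of \<open>L_square\<close>.\<close>

lemma L_mult:
  assumes "f \<in> cspan (range e)" "g \<in> cspan (range e)"
  shows "L (\<lambda>x. f x * g x) = L f * L g"
proof -
  note G = polynomials_G[OF assms(1)] polynomials_G[OF assms(2)]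
  have "L (\<lambda>x. (f x + g x) * (f x + g x)) = L (\<lambda>x. f x * f x + (2 * (f x * g x) + g x * g x))"
    by (simp add: algebra_simps)
  also have "\<dots> = L f * L f + (2 * L (\<lambda>x. f x * g x) + L g * L g)"
    using G by (simp add: L_add L_scale G_mult G_scale G_add L_square assms)
  also have "L (\<lambda>x. (f x + g x) * (f x + g x)) = (L f + L g) * (L f + L g)"
    using G by (simp add: L_square[OF cspan_add[OF assms]] L_add)
  finally show ?thesis by (simp add: algebra_simps)
qed

text \<open>The factorization axiom is preserved when characters are conjugated and
  \<open>s\<close>, \<open>t\<close> exchanged; hence all results for holomorphic polynomials also
  hold for conjugated ones.\<close>

lemma cnj_moment_functional: "moment_functional G L K C (\<lambda>s x. cnj (e s x))"
proof unfold_locales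
  fix s t
  show "L (\<lambda>x. cnj (e s x) * cnj (cnj (e t x))) = L (\<lambda>x. cnj (e s x)) * L (\<lambda>x. cnj (cnj (e t x)))"
    using L_factor[of t s] by (simp add: mult.commute)
qed (use L_e_1 in \<open>auto simp: G_add G_scale G_mult G_bounded L_add L_scale L_bound C_nonneg e_G cnj_e_G e_mult cnj_e_1\<close>)

section \<open>The star-algebra generated by the evaluations\<close>

definition star_algebra :: "('a \<Rightarrow> complex) set" where
  "star_algebra = cspan (range (\<lambda>(s, t) x. e s x * cnj (e t x)))"

lemma range_star_mult:
  "b \<in> range (\<lambda>(s, t) x. e s x * cnj (e t x)) \<Longrightarrow> b' \<in> range (\<lambda>(s, t) x. e s x * cnj (e t x)) \<Longrightarrow>
   (\<lambda>x. b x * b' x) \<in> range (\<lambda>(s, t) x. e s x * cnj (e t x))"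
proof -
  assume "b \<in> range (\<lambda>(s, t) x. e s x * cnj (e t x))" "b' \<in> range (\<lambda>(s, t) x. e s x * cnj (e t x))"
  then obtain s t s' t' where "b = (\<lambda>x. e s x * cnj (e t x))" "b' = (\<lambda>x. e s' x * cnj (e t' x))" by auto
  then have "(\<lambda>x. b x * b' x) = (\<lambda>(s, t) x. e s x * cnj (e t x)) (s * s', t * t')"
    by (simp add: e_mult mult_ac)
  then show ?thesis by (rule range_eqI)
qed

lemma star_algebra_add: "f \<in> star_algebra \<Longrightarrow> g \<in> star_algebra \<Longrightarrow> (\<lambda>x. f x + g x) \<in> star_algebra"
  and star_algebra_diff: "f \<in> star_algebra \<Longrightarrow> g \<in> star_algebra \<Longrightarrow> (\<lambda>x. f x - g x) \<in> star_algebra"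
  and star_algebra_scale: "f \<in> star_algebra \<Longrightarrow> (\<lambda>x. a * f x) \<in> star_algebra"
  and star_algebra_sum: "(\<And>i. i \<in> I \<Longrightarrow> F i \<in> star_algebra) \<Longrightarrow> (\<lambda>x. \<Sum>i\<in>I. F i x) \<in> star_algebra"
  and star_algebra_mult: "f \<in> star_algebra \<Longrightarrow> g \<in> star_algebra \<Longrightarrow> (\<lambda>x. f x * g x) \<in> star_algebra"
  unfolding star_algebra_def
  by (erule (1) cspan_add cspan_diff | erule cspan_scale | rule cspan_sum | (rule cspan_mult[OF range_star_mult]) | assumption)+

lemma star_algebra_power: "f \<in> star_algebra \<Longrightarrow> (\<lambda>x. f x ^ Suc n) \<in> star_algebra"
  unfolding star_algebra_def by (rule cspan_power[OF range_star_mult])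

lemma star_algebra_cnj: "f \<in> star_algebra \<Longrightarrow> (\<lambda>x. cnj (f x)) \<in> star_algebra"
  unfolding star_algebra_def
proof (erule cspan_cnj)
  fix b assume "b \<in> range (\<lambda>(s, t) x. e s x * cnj (e t x))"
  then obtain s t where "b = (\<lambda>x. e s x * cnj (e t x))" by auto
  then have "(\<lambda>x. cnj (b x)) = (\<lambda>(s, t) x. e s x * cnj (e t x)) (t, s)"
    by (simp add: mult.commute)
  then have "(\<lambda>x. cnj (b x)) \<in> range (\<lambda>(s, t) x. e s x * cnj (e t x))"
    by (rule range_eqI)
  then show "(\<lambda>x. cnj (b x)) \<in> cspan (range (\<lambda>(s, t) x. e s x * cnj (e t x)))"
    by (rule cspan_base)
qed

lemma e_star_algebra: "e s \<in> star_algebra"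
proof -
  have "e s = (\<lambda>(s, t) x. e s x * cnj (e t x)) (s, 1)"
    by (simp add: fun_eq_iff cnj_e_1 flip: e_mult)
  then show ?thesis
    unfolding star_algebra_def by (intro cspan_base range_eqI)
qed

lemma star_algebra_G: "f \<in> star_algebra \<Longrightarrow> f \<in> G"
  unfolding star_algebra_def
  by (erule cspan_subset) (auto intro: G_add G_scale G_zero G_mult e_G cnj_e_G)

lemma e_1_star: "f \<in> star_algebra \<Longrightarrow> f x * e 1 x = f x"
  unfolding star_algebra_def
proof (induction rule: cspan.induct)
  case (step b f c)
  then obtain s t where b: "b = (\<lambda>x. e s x * cnj (e t x))" by auto
  have "b x * e 1 x = e (s * 1) x * cnj (e t x)"
    unfolding b e_mult by (simp only: mult_ac)
  then have "b x * e 1 x = b x" by (simp add: b)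
  then show ?case using step.IH by (simp only: distrib_right mult.assoc)
qed simp

text \<open>On generators, \<open>L_factor\<close> separates holomorphic and conjugated parts;
  \<open>L_mult\<close> for \<open>e\<close> and for its conjugate handles each part, and
  \<open>L_factor\<close> reassembles them.\<close>

lemma L_star_mult:
  assumes "f \<in> star_algebra" "g \<in> star_algebra"
  shows "L (\<lambda>x. f x * g x) = L f * L g"
proof (rule cspan_functional_mult[where B = "range (\<lambda>(s, t) x. e s x * cnj (e t x))"])
  interpret conj: moment_functional G L K C "\<lambda>s x. cnj (e s x)"
    by (rule cnj_moment_functional)
  fix b b'
  assume "b \<in> range (\<lambda>(s, t) x. e s x * cnj (e t x))" "b' \<in> range (\<lambda>(s, t) x. e s x * cnj (e t x))"
  then obtain s t s' t' where b: "b = (\<lambda>x. e s x * cnj (e t x))" "b' = (\<lambda>x. e s' x * cnj (e t' x))" by auto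
  have "L (\<lambda>x. b x * b' x) = L (\<lambda>x. e (s * s') x * cnj (e (t * t') x))"
    by (simp add: b e_mult mult_ac)
  also have "\<dots> = L (\<lambda>x. e s x * e s' x) * L (\<lambda>x. cnj (e t x) * cnj (e t' x))"
    unfolding L_factor by (simp add: e_mult[abs_def])
  also have "\<dots> = L b * L b'"
    using L_mult[of "e s" "e s'"] conj.L_mult[of "\<lambda>x. cnj (e t x)" "\<lambda>x. cnj (e t' x)"]
    by (simp add: cspan_base b L_factor)
  finally show "L (\<lambda>x. b x * b' x) = L b * L b'" .
qed (use assms L_zero L_add L_scale star_algebra_G range_star_mult in \<open>auto simp: star_algebra_def\<close>)

lemma star_algebra_continuous:
  assumes "\<And>s. continuous_on K (e s)" "f \<in> star_algebra"
  shows "continuous_on K f"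
  using assms(2) unfolding star_algebra_def
  by (rule cspan_subset[where X = "{f. continuous_on K f}", simplified])
    (auto intro!: continuous_intros assms(1))

text \<open>Were the claim false, then by compactness some finite sum \<open>h\<close> of functions \<open>\<bar>f - L f\<bar>\<^sup>2\<close>
  would be strictly positive on \<open>K\<close> although \<open>L h = 0\<close>. Then the powers of \<open>1 - h / sup h\<close>
  tend to \<open>0\<close> uniformly while \<open>L\<close> maps them to \<open>1\<close>.\<close>

lemma L_eq_evaluation:
  assumes K: "compact K" and cont: "\<And>s. continuous_on K (e s)" and one: "\<And>x. x \<in> K \<Longrightarrow> e 1 x = 1"
  shows "\<exists>x\<in>K. \<forall>f\<in>star_algebra. L f = f x"
proof (rule ccontr)
  assume "\<not> ?thesis"
  then obtain F where F: "\<And>x. x \<in> K \<Longrightarrow> F x \<in> star_algebra" "\<And>x. x \<in> K \<Longrightarrow> L (F x) \<noteq> F x x"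
    by metis
  \<comment> \<open>\<open>L (F x)\<close> is multiplied by \<open>e 1\<close> to stay in the
    algebra. Then \<open>L (k x) = 0\<close>, whereas \<open>k x x\<close> is nonzero because
    \<open>e 1\<close> equals 1 on \<open>K\<close>.\<close>
  define k where "k x y = F x y - L (F x) * e 1 y" for x y
  have k: "k x \<in> star_algebra" if "x \<in> K" for x
    unfolding k_def[abs_def] by (intro star_algebra_diff star_algebra_scale F e_star_algebra that)
  have L_k: "L (k x) = 0" if "x \<in> K" for x
  proof -
    have "L (\<lambda>y. F x y + - L (F x) * e 1 y) = L (F x) + - L (F x) * L (e 1)"
      using F(1)[OF that] by (subst L_add) (auto simp only: L_scale G_scale star_algebra_G e_star_algebra)
    then show ?thesis by (simp add: k_def[abs_def] L_e_1)
  qed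
  have "\<exists>U. open U \<and> x \<in> U \<and> (\<forall>y\<in>K \<inter> U. k x y \<noteq> 0)" if x: "x \<in> K" for x
  proof -
    have "openin (top_of_set K) (K \<inter> k x -` (- {0}))"
      by (rule continuous_openin_preimage_gen[OF star_algebra_continuous[OF cont k[OF x]]]) auto
    then obtain U where "open U" "K \<inter> k x -` (- {0}) = K \<inter> U"
      by (auto simp: openin_open)
    moreover have "k x x \<noteq> 0" using F(2)[OF x] one[OF x] by (simp add: k_def)
    ultimately show ?thesis using x by blast
  qed
  then obtain U where U: "\<And>x. x \<in> K \<Longrightarrow> open (U x)" "\<And>x. x \<in> K \<Longrightarrow> x \<in> U x"
    "\<And>x y. x \<in> K \<Longrightarrow> y \<in> K \<Longrightarrow> y \<in> U x \<Longrightarrow> k x y \<noteq> 0"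
    by (metis IntI)
  obtain I where I: "I \<subseteq> K" "finite I" "K \<subseteq> (\<Union>x\<in>I. U x)"
    using compactE_image[OF K, of K U] U(1,2) by (metis UN_I subsetI)
  \<comment> \<open>\<open>r\<close> and \<open>h\<close> are the same function, once real-valued
    for order and compactness arguments, once complex as a member of the algebra.\<close>
  define r where "r y = (\<Sum>x\<in>I. (cmod (k x y))\<^sup>2)" for y
  define h where "h y = (\<Sum>x\<in>I. k x y * cnj (k x y))" for y
  have kk: "(\<lambda>y. k x y * cnj (k x y)) \<in> star_algebra" if "x \<in> I" for x
    using that I(1) by (intro star_algebra_mult star_algebra_cnj k) auto
  then have h: "h \<in> star_algebra"
    unfolding h_def[abs_def] by (rule star_algebra_sum)
  have h_r: "h y = complex_of_real (r y)" for y
    unfolding h_def r_def complex_norm_square[symmetric] by simp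
  have L_h: "L h = 0"
  proof -
    have "L (\<lambda>y. \<Sum>x\<in>J. k x y * cnj (k x y)) = 0" if "J \<subseteq> I" for J
      using finite_subset[OF that I(2)] that
    proof (induction J rule: finite_induct)
      case (insert x J)
      then have "x \<in> K" and x: "x \<in> I" and J: "\<And>z. z \<in> J \<Longrightarrow> z \<in> I" using I(1) by auto
      then have "L (\<lambda>y. k x y * cnj (k x y)) = 0"
        using L_star_mult[OF k star_algebra_cnj[OF k]] L_k by simp
      moreover have "(\<lambda>y. \<Sum>x\<in>J. k x y * cnj (k x y)) \<in> star_algebra"
        by (intro star_algebra_sum kk J)
      ultimately show ?case
        using insert kk[OF x] by (simp add: L_add star_algebra_G)
    qed (simp add: L_zero)
    from this[of I] show ?thesis by (simp add: h_def[abs_def])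
  qed
  have r_pos: "0 < r y" if y: "y \<in> K" for y
  proof -
    obtain x where "x \<in> I" "y \<in> U x" using I(3) y by blast
    then have "0 < (cmod (k x y))\<^sup>2" using U(3)[of x y] I(1) y by auto
    also have "\<dots> \<le> r y"
      unfolding r_def using \<open>x \<in> I\<close> I(2) by (intro member_le_sum) auto
    finally show ?thesis .
  qed
  \<comment> \<open>Over an empty \<open>K\<close> the bound on \<open>L\<close> would force
    \<open>L (e 1) = 0\<close>.\<close>
  have "K \<noteq> {}"
  proof
    assume "K = {}"
    then have "cmod (L (e 1)) \<le> C * 0"
      by (intro L_bound e_G) auto
    then show False by (simp add: L_e_1)
  qed
  have "continuous_on K (k x)" if "x \<in> I" for x
    using that I(1) by (intro star_algebra_continuous[OF cont] k) auto
  then have r_cont: "continuous_on K r"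
    unfolding r_def[abs_def] by (intro continuous_on_sum continuous_on_power continuous_on_norm)
  obtain x0 where x0: "x0 \<in> K" "\<And>y. y \<in> K \<Longrightarrow> r x0 \<le> r y"
    using continuous_attains_inf[OF K \<open>K \<noteq> {}\<close> r_cont] by blast
  obtain x1 where x1: "x1 \<in> K" "\<And>y. y \<in> K \<Longrightarrow> r y \<le> r x1"
    using continuous_attains_sup[OF K \<open>K \<noteq> {}\<close> r_cont] by blast
  define q where "q = 1 - r x0 / r x1"
  have q: "0 \<le> q" "q < 1"
    using r_pos[OF x0(1)] r_pos[OF x1(1)] x0(2)[OF x1(1)] by (auto simp: q_def)
  define w where "w y = e 1 y - (1 / r x1) * h y" for y
  have w: "w \<in> star_algebra"
    unfolding w_def[abs_def] by (intro star_algebra_diff star_algebra_scale h e_star_algebra)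
  have "L (\<lambda>y. e 1 y + - (1 / r x1) * h y) = L (e 1) + - (1 / r x1) * L h"
    by (subst L_add) (auto simp only: L_scale G_scale star_algebra_G e_star_algebra h)
  then have L_w: "L w = 1" by (simp add: w_def[abs_def] L_h L_e_1)
  have w_le: "cmod (w y) \<le> q" if y: "y \<in> K" for y
  proof -
    have "w y = complex_of_real (1 - r y / r x1)"
      by (simp add: w_def h_r one[OF y])
    then have "cmod (w y) = \<bar>1 - r y / r x1\<bar>" by (simp only: norm_of_real)
    moreover have "r y / r x1 \<le> 1" "r x0 / r x1 \<le> r y / r x1"
      using x1(2)[OF y] x0(2)[OF y] r_pos[OF x1(1)] by (auto intro: divide_right_mono)
    ultimately show ?thesis by (simp add: q_def)
  qed
  have "1 \<le> C * q ^ Suc n" for n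
  proof -
    have "L (\<lambda>y. w y ^ Suc n) = 1"
    proof (induction n)
      case (Suc n)
      have "L (\<lambda>y. w y * w y ^ Suc n) = L w * L (\<lambda>y. w y ^ Suc n)"
        by (intro L_star_mult w star_algebra_power)
      with Suc show ?case by (simp add: L_w)
    qed (simp add: L_w)
    moreover have "cmod (L (\<lambda>y. w y ^ Suc n)) \<le> C * q ^ Suc n"
    proof (rule L_bound)
      show "cmod (w y ^ Suc n) \<le> q ^ Suc n" if "y \<in> K" for y
        unfolding norm_power using w_le[OF that] by (rule power_mono) simp
    qed (use w q in \<open>auto intro: star_algebra_G star_algebra_power simp del: power_Suc\<close>)
    ultimately show ?thesis by simp
  qed
  moreover have "(\<lambda>n. C * q ^ Suc n) \<longlonglongrightarrow> C * 0"
    using q by (intro tendsto_mult tendsto_const LIMSEQ_Suc LIMSEQ_power_zero) auto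
  ultimately have "1 \<le> C * 0"
    by (intro LIMSEQ_le_const) auto
  then show False by simp
qed

end

section \<open>Regular complex measures\<close>

lemma open_vimage_apply:
  fixes W :: "'b::topological_space set"
  assumes "open W"
  shows "open ((\<lambda>h :: 'a \<Rightarrow> 'b. h i) -` W)"
  using continuous_on_open_vimage[of UNIV "\<lambda>h :: 'a \<Rightarrow> 'b. h i"] assms by simp

instance "fun" :: (type, t0_space) t0_space
proof
  fix f g :: "'a \<Rightarrow> 'b"
  assume "f \<noteq> g"
  then obtain i where "f i \<noteq> g i" by auto
  then obtain U where "open U" "\<not> (f i \<in> U \<longleftrightarrow> g i \<in> U)"
    using t0_space_class.t0_space[OF \<open>f i \<noteq> g i\<close>] by blast
  then show "\<exists>U. open U \<and> \<not> (f \<in> U \<longleftrightarrow> g \<in> U)"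
    by (intro exI[of _ "(\<lambda>h. h i) -` U"]) (simp add: open_vimage_apply)
qed

instance "fun" :: (type, t1_space) t1_space
proof
  fix f g :: "'a \<Rightarrow> 'b"
  assume "f \<noteq> g"
  then obtain i where "f i \<noteq> g i" by auto
  then obtain U where "open U" "f i \<in> U" "g i \<notin> U"
    using t1_space_class.t1_space[OF \<open>f i \<noteq> g i\<close>] by blast
  then show "\<exists>U. open U \<and> f \<in> U \<and> g \<notin> U"
    by (intro exI[of _ "(\<lambda>h. h i) -` U"]) (simp add: open_vimage_apply)
qed

text \<open>Two functions are separated in a coordinate where they differ. Hausdorffness makes
  compact sets closed, hence Borel, so that \<open>mass\<close> can be applied to them.\<close>

instance "fun" :: (type, t2_space) t2_space
proof
  fix f g :: "'a \<Rightarrow> 'b"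
  assume "f \<noteq> g"
  then obtain i where "f i \<noteq> g i" by auto
  then obtain U V where "open U" "open V" "f i \<in> U" "g i \<in> V" "U \<inter> V = {}"
    using hausdorff[OF \<open>f i \<noteq> g i\<close>] by blast
  then show "\<exists>U V. open U \<and> open V \<and> f \<in> U \<and> g \<in> V \<and> U \<inter> V = {}"
    by (intro exI[of _ "(\<lambda>h. h i) -` U"] exI[of _ "(\<lambda>h. h i) -` V"])
      (simp add: open_vimage_apply flip: vimage_Int)
qed

context complex_measure_on
begin

lemma mass_Un_le:
  assumes "A \<in> sets M" "B \<in> sets M"
  shows "mass (A \<union> B) \<le> mass A + mass B"
  unfolding mass_def sum.distrib[symmetric]
  using assms by (intro sum_mono measure_Un_le) (auto simp: sets_part)

lemma mass_mono:
  assumes "A \<in> sets M" "B \<in> sets M" "A \<subseteq> B"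
  shows "mass A \<le> mass B"
  unfolding mass_def
  using assms by (intro sum_mono finite_measure.finite_measure_mono[OF finite_measure_part])
    (auto simp: sets_part)

lemma mass_empty: "mass {} = 0"
  by (simp add: mass_def)

lemma AE_part:
  assumes "N \<in> sets M" "mass (space M - N) = 0" "c \<in> quarter_turns"
  shows "AE x in part c. x \<in> N"
proof -
  have "measure (part c) (space M - N) \<le> mass (space M - N)"
    unfolding mass_def using assms(3) finite_quarter_turns by (intro member_le_sum) auto
  then have "emeasure (part c) (space M - N) = 0"
    using assms(2) finite_measure.emeasure_eq_measure[OF finite_measure_part]
    by (simp add: measure_nonneg antisym)
  then show ?thesis
    using assms(1) by (intro AE_I[where N = "space M - N"]) (auto simp: space_part sets_part)
qed

text \<open>For each \<open>part c\<close> the integrand equals \<open>f x\<close> almost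
  everywhere. This evaluates all integrals in the converse direction of the theorem.\<close>

lemma complex_integral_point_mass:
  assumes f: "f \<in> borel_measurable M" and x: "{x} \<in> sets M" and "mass (space M - {x}) = 0"
  shows "complex_integral M \<mu> f = f x * \<mu> (space M)"
proof -
  have "integral\<^sup>L (part c) f = f x * measure (part c) (space M)" if "c \<in> quarter_turns" for c
  proof -
    have "integral\<^sup>L (part c) f = integral\<^sup>L (part c) (\<lambda>_. f x)"
      using f AE_part[OF x assms(3) that] by (intro integral_cong_AE) auto
    then show ?thesis by (simp add: space_part scaleR_conv_of_real)
  qed
  then show ?thesis
    by (simp add: complex_integral_eq decomposition sum_distrib_left mult_ac)
qed

end

locale regular_complex_measure = complex_measure_on "borel_on S" \<mu>
  for S :: "'b::t2_space set" and \<mu> +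
  assumes regular: "regular_on S \<mu>"
begin

abbreviation supp :: "'b set" where
  "supp \<equiv> measure_support S \<mu>"

lemma sets_compact: "compact X \<Longrightarrow> X \<subseteq> S \<Longrightarrow> X \<in> sets (borel_on S)"
  by (auto simp: sets_restrict_space intro!: image_eqI[of _ _ X] borel_closed compact_imp_closed)

lemma sets_openin:
  assumes "openin (top_of_set S) U"
  shows "U \<in> sets (borel_on S)"
proof -
  obtain T where "open T" "U = S \<inter> T" using assms by (auto simp: openin_open)
  then show ?thesis by (simp add: sets_restrict_space)
qed

text \<open>Inner regularity with error \<open>\<epsilon> / 4\<close>, which offsets the factor 4
  between \<open>mass\<close> and total variation.\<close>

lemma compact_approximation:
  assumes E: "E \<in> sets (borel_on S)" and "0 < \<epsilon>"
  shows "\<exists>X. compact X \<and> X \<subseteq> E \<and> mass (E - X) \<le> \<epsilon>"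
proof -
  have ES: "E \<subseteq> S" using sets.sets_into_space[OF E] by (simp add: space_restrict_space)
  have TV: "total_variation (borel_on S) \<mu> E =
      (SUP X \<in> {X. compact X \<and> X \<subseteq> E}. total_variation (borel_on S) \<mu> X)"
    using regular E unfolding regular_on_def by blast
  have fin: "total_variation (borel_on S) \<mu> E \<noteq> \<infinity>"
    using total_variation_le_mass[OF E] by (auto simp: top_unique)
  have "\<exists>X\<in>{X. compact X \<and> X \<subseteq> E}. total_variation (borel_on S) \<mu> E
      < total_variation (borel_on S) \<mu> X + ennreal (\<epsilon> / 4)"
    by (rule SUP_approx_ennreal[OF _ _ TV fin]) (use \<open>0 < \<epsilon>\<close> in \<open>auto intro: exI[of _ "{}"]\<close>)
  then obtain X where X: "compact X" "X \<subseteq> E"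
    "total_variation (borel_on S) \<mu> E \<le> total_variation (borel_on S) \<mu> X + ennreal (\<epsilon> / 4)"
    by (auto simp: less_imp_le)
  have "X \<in> sets (borel_on S)"
    using X ES by (intro sets_compact) auto
  then have "mass (E - X) \<le> 4 * (\<epsilon> / 4)"
    using E X \<open>0 < \<epsilon>\<close> by (intro mass_le_total_variation) auto
  with X show ?thesis by auto
qed

lemma supp_subset: "supp \<subseteq> S"
  by (auto simp: measure_support_def)

text \<open>The complement of the support is covered by null open sets, possibly uncountably many. A
  compact subset needs only finitely many of them, so it is null, and inner regularity extends this
  to the whole complement.\<close>

lemma mass_off_support:
  assumes "compact supp"
  shows "mass (S - supp) = 0"
proof -
  have KM: "supp \<in> sets (borel_on S)"
    using assms supp_subset by (rule sets_compact)
  have SM: "S \<in> sets (borel_on S)"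
    using sets.top[of "borel_on S"] by (simp add: space_restrict_space)
  have null: "mass X = 0" if X: "compact X" "X \<subseteq> S - supp" for X
  proof -
    have "\<exists>V. open V \<and> x \<in> V \<and> mass (V \<inter> S) = 0" if "x \<in> X" for x
    proof -
      obtain U where U: "openin (top_of_set S) U" "x \<in> U" "total_variation (borel_on S) \<mu> U = 0"
        using X(2) \<open>x \<in> X\<close> unfolding measure_support_def by blast
      \<comment> \<open>The instance of \<open>mass_le_total_variation\<close> with empty
        \<open>C\<close> and \<open>b = 0\<close>.\<close>
      have "mass (U - {}) \<le> 4 * 0"
        using U by (intro mass_le_total_variation sets_openin) auto
      then have "mass U = 0" using mass_nonneg[of U] by simp
      moreover obtain V where "open V" "U = S \<inter> V" using U(1) by (auto simp: openin_open)
      ultimately show ?thesis using U(2) by (auto simp: Int_commute)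
    qed
    then obtain V where V: "\<And>x. x \<in> X \<Longrightarrow> open (V x)" "\<And>x. x \<in> X \<Longrightarrow> x \<in> V x"
      "\<And>x. x \<in> X \<Longrightarrow> mass (V x \<inter> S) = 0" by metis
    obtain I where I: "I \<subseteq> X" "finite I" "X \<subseteq> (\<Union>x\<in>I. V x)"
      using compactE_image[OF X(1), of X V] V(1,2) by (metis UN_I subsetI)
    have VM: "V x \<inter> S \<in> sets (borel_on S)" if "x \<in> X" for x
      using V(1)[OF that] by (intro sets_openin) (auto simp: openin_open)
    have "mass (\<Union>x\<in>J. V x \<inter> S) = 0" if "J \<subseteq> I" for J
      using finite_subset[OF that I(2)] that
    proof (induction J rule: finite_induct)
      case (insert x J)
      have "(\<Union>x\<in>J. V x \<inter> S) \<in> sets (borel_on S)"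
        using insert I(1) VM by (intro sets.finite_UN) auto
      then have "mass ((V x \<inter> S) \<union> (\<Union>x\<in>J. V x \<inter> S)) \<le> mass (V x \<inter> S) + mass (\<Union>x\<in>J. V x \<inter> S)"
        using insert I(1) VM by (intro mass_Un_le) auto
      moreover have "mass (V x \<inter> S) = 0" "mass (\<Union>x\<in>J. V x \<inter> S) = 0"
        using insert I(1) V(3) by auto
      ultimately show ?case
        using mass_nonneg[of "\<Union>x\<in>insert x J. V x \<inter> S"] unfolding UN_insert by linarith
    qed (simp add: mass_empty)
    then have "mass (\<Union>x\<in>I. V x \<inter> S) = 0" by simp
    moreover have "X \<in> sets (borel_on S)"
      using X by (intro sets_compact) auto
    then have "mass X \<le> mass (\<Union>x\<in>I. V x \<inter> S)"
      using I X VM by (intro mass_mono sets.finite_UN) auto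
    ultimately show ?thesis using mass_nonneg[of X] by simp
  qed
  have "mass (S - supp) \<le> \<epsilon>" if \<epsilon>: "0 < \<epsilon>" for \<epsilon>
  proof -
    have D: "S - supp \<in> sets (borel_on S)" using KM SM by auto
    obtain X where X: "compact X" "X \<subseteq> S - supp" "mass (S - supp - X) \<le> \<epsilon>"
      using compact_approximation[OF D \<epsilon>] by blast
    have "X \<in> sets (borel_on S)"
      using X by (intro sets_compact) auto
    then have "mass (X \<union> (S - supp - X)) \<le> mass X + mass (S - supp - X)"
      using D by (intro mass_Un_le sets.Diff[OF D])
    moreover have "X \<union> (S - supp - X) = S - supp" using X by blast
    ultimately show ?thesis using null[OF X(1,2)] X(3) by simp
  qed
  then have "mass (S - supp) \<le> 0" by (rule field_le_epsilon[where y = 0, simplified])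
  then show ?thesis using mass_nonneg[of "S - supp"] by simp
qed

end

section \<open>Measures on the space of characters\<close>

text \<open>Extending by 0 makes \<open>s \<mapsto> character_eval s \<rho>\<close> multiplicative for every function \<open>\<rho>\<close>, but
  \<open>character_eval 1\<close> is then only the indicator of \<open>nonzero_mult\<close>.\<close>

definition character_eval :: "'s::comm_monoid_mult \<Rightarrow> ('s \<Rightarrow> complex) \<Rightarrow> complex" where
  "character_eval s \<rho> = (if \<rho> \<in> nonzero_mult then \<rho> s else 0)"

lemma nonzero_mult_1:
  assumes "\<rho> \<in> nonzero_mult"
  shows "\<rho> 1 = 1"
proof -
  obtain s where "\<rho> s \<noteq> 0" using assms unfolding nonzero_mult_def by auto
  moreover have "\<rho> (s * 1) = \<rho> s * \<rho> 1"
    using assms unfolding nonzero_mult_def multiplicative_def by blast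
  ultimately show ?thesis by simp
qed

lemma character_eval_mult: "character_eval (s * t) \<rho> = character_eval s \<rho> * character_eval t \<rho>"
  by (simp add: character_eval_def nonzero_mult_def multiplicative_def)

lemma measurable_coordinate: "(\<lambda>\<rho> :: 's::comm_monoid_mult \<Rightarrow> complex. \<rho> s) \<in> borel_measurable (borel_on X)"
  by (intro measurable_restrict_space1 borel_measurable_continuous_onI continuous_on_product_coordinates)

lemma measurable_character_eval: "character_eval s \<in> borel_measurable (borel_on nonzero_mult)"
  using measurable_coordinate[of s nonzero_mult]
  by (rule measurable_cong[THEN iffD1, rotated]) (simp add: character_eval_def space_restrict_space)

locale character_measure = regular_complex_measure nonzero_mult \<mu>
  for \<mu> :: "('s::comm_monoid_mult \<Rightarrow> complex) set \<Rightarrow> complex" +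
  assumes compact_supp: "compact supp"
    and nonzero: "\<mu> nonzero_mult \<noteq> 0"
begin

abbreviation \<B> :: "('s \<Rightarrow> complex) measure" where
  "\<B> \<equiv> borel_on nonzero_mult"

lemma space_\<B>: "space \<B> = nonzero_mult"
  by (simp add: space_restrict_space)

text \<open>Bounds are required on the support only: evaluations may be unbounded on
  \<open>nonzero_mult\<close>, but the integrals see nothing off the support.\<close>

definition tame :: "(('s \<Rightarrow> complex) \<Rightarrow> complex) set" where
  "tame = {f \<in> borel_measurable \<B>. \<exists>b. \<forall>x\<in>supp. cmod (f x) \<le> b}"

definition mean :: "(('s \<Rightarrow> complex) \<Rightarrow> complex) \<Rightarrow> complex" where
  "mean f = complex_integral \<B> \<mu> f / \<mu> nonzero_mult"

lemma supp_sets: "supp \<in> sets \<B>"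
  using compact_supp supp_subset by (rule sets_compact)

lemma AE_supp: "c \<in> quarter_turns \<Longrightarrow> AE x in part c. x \<in> supp"
  using AE_part[OF supp_sets] mass_off_support[OF compact_supp] by (simp add: space_\<B>)

lemma tame_integrable:
  assumes "f \<in> tame" "c \<in> quarter_turns"
  shows "integrable (part c) f"
proof -
  obtain b where f: "f \<in> borel_measurable \<B>" and b: "\<And>x. x \<in> supp \<Longrightarrow> cmod (f x) \<le> b"
    using assms(1) unfolding tame_def by blast
  interpret finite_measure "part c" by (rule finite_measure_part)
  show ?thesis
  proof (rule integrable_const_bound[where B = b])
    show "AE x in part c. cmod (f x) \<le> b"
      using AE_supp[OF assms(2)] by (rule eventually_mono) (rule b)
  qed (use f in measurable)
qed

lemma tame_add: "f \<in> tame \<Longrightarrow> g \<in> tame \<Longrightarrow> (\<lambda>x. f x + g x) \<in> tame"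
proof -
  assume f: "f \<in> tame" and g: "g \<in> tame"
  obtain a b where "\<And>x. x \<in> supp \<Longrightarrow> cmod (f x) \<le> a" "\<And>x. x \<in> supp \<Longrightarrow> cmod (g x) \<le> b"
    using f g unfolding tame_def by blast
  then have "\<forall>x\<in>supp. cmod (f x + g x) \<le> a + b"
    by (blast intro: norm_triangle_mono)
  moreover have "(\<lambda>x. f x + g x) \<in> borel_measurable \<B>"
    using f g unfolding tame_def by (intro borel_measurable_add) auto
  ultimately show ?thesis unfolding tame_def by blast
qed

lemma tame_mult: "f \<in> tame \<Longrightarrow> g \<in> tame \<Longrightarrow> (\<lambda>x. f x * g x) \<in> tame"
proof -
  assume f: "f \<in> tame" and g: "g \<in> tame"
  obtain a b where ab: "\<And>x. x \<in> supp \<Longrightarrow> cmod (f x) \<le> a" "\<And>x. x \<in> supp \<Longrightarrow> cmod (g x) \<le> b"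
    using f g unfolding tame_def by blast
  have "cmod (f x * g x) \<le> a * b" if "x \<in> supp" for x
    unfolding norm_mult using ab[OF that] by (meson mult_mono norm_ge_zero order_trans)
  moreover have "(\<lambda>x. f x * g x) \<in> borel_measurable \<B>"
    using f g unfolding tame_def by (intro borel_measurable_times) auto
  ultimately show ?thesis unfolding tame_def by blast
qed

lemma tame_const: "(\<lambda>_. a) \<in> tame"
  unfolding tame_def by auto

lemma tame_scale: "f \<in> tame \<Longrightarrow> (\<lambda>x. a * f x) \<in> tame"
  by (rule tame_mult[OF tame_const])

lemma mean_add: "f \<in> tame \<Longrightarrow> g \<in> tame \<Longrightarrow> mean (\<lambda>x. f x + g x) = mean f + mean g"
  by (simp add: mean_def complex_integral_add tame_integrable add_divide_distrib)

lemma mean_scale: "mean (\<lambda>x. a * f x) = a * mean f"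
  by (simp add: mean_def complex_integral_mult)

lemma mean_bound:
  assumes f: "f \<in> tame" and "0 \<le> b" and b: "\<And>x. x \<in> supp \<Longrightarrow> cmod (f x) \<le> b"
  shows "cmod (mean f) \<le> mass nonzero_mult / cmod (\<mu> nonzero_mult) * b"
proof -
  have "cmod (complex_integral \<B> \<mu> f) \<le> b * mass (space \<B>) + 0 * mass {}"
  proof (rule norm_complex_integral_le)
    show "AE x in part c. cmod (f x) \<le> b + indicator {} x * 0" if "c \<in> quarter_turns" for c
      using AE_supp[OF that] by (rule eventually_mono) (simp add: b)
  qed (use f \<open>0 \<le> b\<close> in \<open>auto simp: tame_def\<close>)
  then show ?thesis
    by (simp add: mean_def norm_divide space_\<B> divide_right_mono mult.commute)
qed

lemma complex_integral_cong:
  assumes "\<And>x. x \<in> nonzero_mult \<Longrightarrow> f x = g x"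
  shows "complex_integral \<B> \<mu> f = complex_integral \<B> \<mu> g"
  unfolding complex_integral_eq
  using assms by (intro sum.cong refl arg_cong2[where f = "(*)"] Bochner_Integration.integral_cong)
    (auto simp: space_part space_\<B>)

lemma continuous_on_character_eval: "continuous_on supp (character_eval s)"
  by (rule continuous_on_cong[THEN iffD2, OF refl _ continuous_on_product_coordinates[THEN continuous_on_subset]])
    (use supp_subset in \<open>auto simp: character_eval_def\<close>)

lemma character_eval_tame: "character_eval s \<in> tame"
  and cnj_character_eval_tame: "(\<lambda>x. cnj (character_eval s x)) \<in> tame"
proof -
  have "bounded (character_eval s ` supp)"
    using compact_supp continuous_on_character_eval by (intro compact_imp_bounded compact_continuous_image)
  then obtain b where "\<forall>x\<in>supp. cmod (character_eval s x) \<le> b"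
    by (auto simp: bounded_iff)
  moreover note m = measurable_character_eval[of s]
  moreover have "(\<lambda>x. cnj (character_eval s x)) \<in> borel_measurable \<B>"
    using m by (rule measurable_compose) (intro borel_measurable_continuous_onI continuous_intros)
  ultimately show "character_eval s \<in> tame" "(\<lambda>x. cnj (character_eval s x)) \<in> tame"
    unfolding tame_def by auto
qed

lemma moment_functional_mean:
  assumes "\<And>s t. mean (\<lambda>\<rho>. character_eval s \<rho> * cnj (character_eval t \<rho>)) =
    mean (character_eval s) * mean (\<lambda>\<rho>. cnj (character_eval t \<rho>))"
  shows "moment_functional tame mean supp (mass nonzero_mult / cmod (\<mu> nonzero_mult)) character_eval"
proof
  show "mean (character_eval 1) = 1"
  proof -
    have "complex_integral \<B> \<mu> (character_eval 1) = complex_integral \<B> \<mu> (indicator nonzero_mult)"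
      by (intro complex_integral_cong) (simp add: character_eval_def nonzero_mult_1)
    also have "\<dots> = \<mu> nonzero_mult"
      using sets.top[of \<B>] by (intro complex_integral_indicator) (simp add: space_\<B>)
    finally show ?thesis using nonzero by (simp add: mean_def)
  qed
  show "0 \<le> mass nonzero_mult / cmod (\<mu> nonzero_mult)"
    by (simp add: mass_nonneg)
  show "\<exists>b. \<forall>x\<in>supp. cmod (f x) \<le> b" if "f \<in> tame" for f
    using that by (simp add: tame_def)
qed (rule assms tame_add tame_scale tame_mult mean_add mean_scale mean_bound
      character_eval_tame cnj_character_eval_tame character_eval_mult | assumption | blast)+

text \<open>If \<open>E\<close> avoids \<open>\<gamma>\<close>, choose \<open>f\<close> in the
  algebra close to 1 on most of \<open>E\<close> and close to 0 at \<open>\<gamma>\<close> and on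
  most of the complement. Its integral is close to \<open>\<mu> E\<close>, yet equals
  \<open>\<mu> nonzero_mult * f \<gamma>\<close>, which is small.\<close>

lemma point_mass_of_factorization:
  assumes factor: "\<And>s t. mean (\<lambda>\<rho>. character_eval s \<rho> * cnj (character_eval t \<rho>)) =
    mean (character_eval s) * mean (\<lambda>\<rho>. cnj (character_eval t \<rho>))"
  shows "\<exists>\<gamma>\<in>nonzero_mult. (\<forall>s. mean (character_eval s) = \<gamma> s) \<and> (\<forall>E\<in>sets \<B>. \<gamma> \<notin> E \<longrightarrow> \<mu> E = 0)"
proof -
  interpret moment_functional tame mean supp "mass nonzero_mult / cmod (\<mu> nonzero_mult)" character_eval
    by (rule moment_functional_mean[OF factor])
  have one: "character_eval 1 x = 1" if "x \<in> supp" for x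
    using that supp_subset by (auto simp: character_eval_def nonzero_mult_1)
  obtain \<gamma> where \<gamma>: "\<gamma> \<in> supp" and mean: "\<And>f. f \<in> star_algebra \<Longrightarrow> mean f = f \<gamma>"
    using L_eq_evaluation[OF compact_supp continuous_on_character_eval one] by blast
  have \<gamma>_char: "\<gamma> \<in> nonzero_mult" using \<gamma> supp_subset by blast
  \<comment> \<open>Multiplication by \<open>character_eval 1\<close> puts constants into
    \<open>R\<close>, as a function ring requires, and changes nothing on the support.\<close>
  define ext where "ext f x = complex_of_real (f x) * character_eval 1 x" for f :: "('s \<Rightarrow> complex) \<Rightarrow> real" and x
  define R where "R = {f. ext f \<in> star_algebra}"
  have ext_supp: "ext f x = complex_of_real (f x)" if "x \<in> supp" for f x
    by (simp add: ext_def one that)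
  interpret R: function_ring_on R supp
  proof
    fix f assume f: "f \<in> R"
    have "continuous_on supp (\<lambda>x. Re (ext f x))"
      using f unfolding R_def
      by (intro continuous_on_Re star_algebra_continuous[OF continuous_on_character_eval]) simp
    then show "continuous_on supp f"
      by (rule continuous_on_cong[THEN iffD1, OF refl, rotated]) (simp add: ext_supp)
  next
    fix f g assume f: "f \<in> R" and g: "g \<in> R"
    have "(\<lambda>x. ext f x + ext g x) \<in> star_algebra"
      using f g unfolding R_def by (intro star_algebra_add) auto
    then show "(\<lambda>x. f x + g x) \<in> R"
      by (simp add: R_def ext_def[abs_def] distrib_right)
    have "(\<lambda>x. ext f x * ext g x) \<in> star_algebra"
      using f g unfolding R_def by (intro star_algebra_mult) auto
    moreover have "ext f x * ext g x = ext (\<lambda>x. f x * g x) x" for x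
      using e_1_idem[of x] by (simp add: ext_def)
    ultimately show "(\<lambda>x. f x * g x) \<in> R"
      by (simp add: R_def)
  next
    fix c
    show "(\<lambda>_. c) \<in> R"
      unfolding R_def ext_def[abs_def] by (simp add: star_algebra_scale e_star_algebra)
  next
    fix x y assume x: "x \<in> supp" and y: "y \<in> supp" and "x \<noteq> y"
    then obtain s where s: "x s \<noteq> y s" by auto
    \<comment> \<open>Distinct characters differ in a complex value, so the real or the imaginary
      part of that evaluation separates them.\<close>
    define re where "re z = Re (character_eval s z)" for z
    define im where "im z = Im (character_eval s z)" for z
    have e1: "character_eval s z * character_eval 1 z = character_eval s z"
      "cnj (character_eval s z) * character_eval 1 z = cnj (character_eval s z)" for z
      using e_1_star[OF e_star_algebra, of s z] e_1_star[OF star_algebra_cnj[OF e_star_algebra], of s z] by auto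
    have "ext re = (\<lambda>z. (1/2) * (character_eval s z + cnj (character_eval s z)))"
    proof
      fix z
      have "ext re z = (1/2) * ((character_eval s z + cnj (character_eval s z)) * character_eval 1 z)"
        by (simp add: ext_def re_def complex_add_cnj)
      then show "ext re z = (1/2) * (character_eval s z + cnj (character_eval s z))"
        by (simp only: distrib_right e1)
    qed
    then have "re \<in> R"
      unfolding R_def mem_Collect_eq
      by (simp only:) (intro star_algebra_scale star_algebra_add star_algebra_cnj e_star_algebra)
    have "ext im = (\<lambda>z. (- \<i>/2) * (character_eval s z - cnj (character_eval s z)))"
    proof
      fix z
      have "ext im z = (- \<i>/2) * ((character_eval s z - cnj (character_eval s z)) * character_eval 1 z)"
        by (simp add: ext_def im_def complex_diff_cnj complex_eq_iff)
      then show "ext im z = (- \<i>/2) * (character_eval s z - cnj (character_eval s z))"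
        by (simp only: left_diff_distrib e1)
    qed
    then have "im \<in> R"
      unfolding R_def mem_Collect_eq
      by (simp only:) (intro star_algebra_scale star_algebra_diff star_algebra_cnj e_star_algebra)
    have "character_eval s x \<noteq> character_eval s y"
      using s x y supp_subset by (auto simp: character_eval_def)
    then have "re x \<noteq> re y \<or> im x \<noteq> im y"
      by (simp add: re_def im_def complex_eq_iff)
    with \<open>re \<in> R\<close> \<open>im \<in> R\<close> show "\<exists>f\<in>R. f x \<noteq> f y" by blast
  qed (rule compact_supp)
  have SM: "nonzero_mult \<in> sets \<B>"
    using sets.top[of \<B>] by (simp add: space_\<B>)
  have "\<mu> E = 0" if E: "E \<in> sets \<B>" and \<gamma>E: "\<gamma> \<notin> E" for E
  proof -
    have ES: "E \<subseteq> nonzero_mult" using sets.sets_into_space[OF E] by (simp add: space_\<B>)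
    \<comment> \<open>The three constants come from the uniform error off the exceptional set, from
      the mass \<open>2 * \<epsilon>\<close> of that set, and from
      \<open>f \<gamma> < \<epsilon>\<close>.\<close>
    have le: "cmod (\<mu> E) \<le> (mass nonzero_mult + 2 + cmod (\<mu> nonzero_mult)) * \<epsilon>"
      if \<epsilon>: "0 < \<epsilon>" "\<epsilon> < 1" for \<epsilon>
    proof -
      obtain X where X: "compact X" "X \<subseteq> E" "mass (E - X) \<le> \<epsilon>"
        using compact_approximation[OF E \<epsilon>(1)] by blast
      have E': "nonzero_mult - E \<in> sets \<B>" using E SM by auto
      obtain Y where Y: "compact Y" "Y \<subseteq> nonzero_mult - E" "mass (nonzero_mult - E - Y) \<le> \<epsilon>"
        using compact_approximation[OF E' \<epsilon>(1)] by blast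
      have XM: "X \<in> sets \<B>" and YM: "Y \<in> sets \<B>"
        using X Y ES by (auto intro!: sets_compact)
      have "closed supp" "closed X" "closed Y"
        using compact_supp X(1) Y(1) by (auto intro: compact_imp_closed)
      then have cl: "closed ((Y \<union> {\<gamma>}) \<inter> supp)" "closed (X \<inter> supp)"
        by (auto intro!: closed_Int closed_Un)
      have "((Y \<union> {\<gamma>}) \<inter> supp) \<inter> (X \<inter> supp) = {}"
        using X(2) Y(2) \<gamma>E by blast
      then obtain f where f: "f \<in> R" "f ` supp \<subseteq> {0..1}"
        "\<And>x. x \<in> (Y \<union> {\<gamma>}) \<inter> supp \<Longrightarrow> f x < \<epsilon>" "\<And>x. x \<in> X \<inter> supp \<Longrightarrow> f x > 1 - \<epsilon>"
        using R.two[OF cl(1) Int_lower2 cl(2) Int_lower2 _ \<epsilon>] by blast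
      \<comment> \<open>On the support outside \<open>D\<close> a point lies in \<open>X\<close> or
        in \<open>Y\<close>, where \<open>f\<close> is within \<open>\<epsilon>\<close> of the
        indicator of \<open>E\<close>. On \<open>D\<close> values in \<open>{0..1}\<close> give an
        error of at most 1.\<close>
      define D where "D = (E - X) \<union> (nonzero_mult - E - Y)"
      have DM: "D \<in> sets \<B>" unfolding D_def using E E' XM YM by auto
      have "mass D \<le> 2 * \<epsilon>"
        using mass_Un_le[of "E - X" "nonzero_mult - E - Y"] E E' XM YM X(3) Y(3) by (simp add: D_def)
      have F: "ext f \<in> star_algebra" using f(1) by (simp add: R_def)
      have indE: "(indicator E :: _ \<Rightarrow> complex) \<in> tame"
        using E by (auto simp: tame_def indicator_def intro!: exI[of _ 1])
      have "cmod (complex_integral \<B> \<mu> (\<lambda>x. indicator E x + - 1 * ext f x)) \<le> \<epsilon> * mass (space \<B>) + 1 * mass D"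
      proof (rule norm_complex_integral_le)
        show "(\<lambda>x. indicator E x + - 1 * ext f x) \<in> borel_measurable \<B>"
          using tame_add[OF indE tame_scale[OF star_algebra_G[OF F]], of "-1"] unfolding tame_def by blast
        show "AE x in part c. cmod (indicator E x + - 1 * ext f x) \<le> \<epsilon> + indicator D x * 1"
          if "c \<in> quarter_turns" for c
          using AE_supp[OF that]
        proof (rule eventually_mono)
          fix x assume x: "x \<in> supp"
          have "indicator E x + - 1 * ext f x = complex_of_real (indicator E x - f x)"
            by (simp add: ext_supp[OF x] indicator_def)
          then have "cmod (indicator E x + - 1 * ext f x) = \<bar>indicator E x - f x\<bar>"
            by (simp only: norm_of_real)
          also have "\<dots> \<le> \<epsilon> + indicator D x * 1"
          proof -
            have "0 \<le> f x" "f x \<le> 1" using f(2) x by auto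
            moreover have "x \<in> nonzero_mult" using x supp_subset by blast
            ultimately show ?thesis
              using f(3)[of x] f(4)[of x] x X(2) Y(2) \<epsilon>
              by (auto simp: D_def indicator_def abs_if)
          qed
          finally show "cmod (indicator E x + - 1 * ext f x) \<le> \<epsilon> + indicator D x * 1" .
        qed
      qed (use \<epsilon> DM in auto)
      also have "complex_integral \<B> \<mu> (\<lambda>x. indicator E x + - 1 * ext f x) = \<mu> E - complex_integral \<B> \<mu> (ext f)"
        using indE star_algebra_G[OF F]
        by (subst complex_integral_add)
          (auto simp only: complex_integral_mult complex_integral_indicator[OF E] intro!: tame_integrable tame_scale, simp)
      \<comment> \<open>Here the evaluation property of \<open>mean\<close> at
        \<open>\<gamma>\<close> enters.\<close>
      also have "complex_integral \<B> \<mu> (ext f) = \<mu> nonzero_mult * complex_of_real (f \<gamma>)"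
        using mean[OF F] nonzero by (simp add: mean_def ext_supp[OF \<gamma>] field_simps)
      finally have "cmod (\<mu> E - \<mu> nonzero_mult * complex_of_real (f \<gamma>)) \<le> \<epsilon> * mass nonzero_mult + 2 * \<epsilon>"
        using \<open>mass D \<le> 2 * \<epsilon>\<close> by (simp add: space_\<B>)
      moreover have "cmod (\<mu> nonzero_mult * complex_of_real (f \<gamma>)) \<le> cmod (\<mu> nonzero_mult) * \<epsilon>"
      proof -
        have "0 \<le> f \<gamma>" "f \<gamma> < \<epsilon>" using f(2,3) \<gamma> by auto
        then show ?thesis unfolding norm_mult by (intro mult_left_mono) auto
      qed
      moreover have "cmod (\<mu> E) \<le> cmod (\<mu> E - \<mu> nonzero_mult * complex_of_real (f \<gamma>))
          + cmod (\<mu> nonzero_mult * complex_of_real (f \<gamma>))"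
        using norm_triangle_sub[of "\<mu> E" "\<mu> nonzero_mult * complex_of_real (f \<gamma>)"] by simp
      ultimately show ?thesis by (simp add: algebra_simps)
    qed
    have "\<forall>\<^sub>F \<epsilon> in at_right 0. cmod (\<mu> E) \<le> (mass nonzero_mult + 2 + cmod (\<mu> nonzero_mult)) * \<epsilon>"
      using le unfolding eventually_at_right_field by (intro exI[of _ 1]) auto
    moreover have "((\<lambda>\<epsilon>. (mass nonzero_mult + 2 + cmod (\<mu> nonzero_mult)) * \<epsilon>)
        \<longlongrightarrow> (mass nonzero_mult + 2 + cmod (\<mu> nonzero_mult)) * 0) (at_right 0)"
      by (intro tendsto_intros)
    ultimately have "cmod (\<mu> E) \<le> (mass nonzero_mult + 2 + cmod (\<mu> nonzero_mult)) * 0"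
      by (intro tendsto_lowerbound) auto
    then show ?thesis by simp
  qed
  moreover have "mean (character_eval s) = \<gamma> s" for s
    using mean[OF e_star_algebra] \<gamma>_char by (simp add: character_eval_def)
  ultimately show ?thesis using \<gamma>_char by blast
qed

end

theorem corollary1:
  fixes \<mu> :: "('s::comm_monoid_mult \<Rightarrow> complex) set \<Rightarrow> complex"
    and \<gamma> :: "'s \<Rightarrow> complex"
  assumes "complex_measure (borel_on nonzero_mult) \<mu>"
    and "regular_on nonzero_mult \<mu>"
    and "compact (measure_support nonzero_mult \<mu>)"
    and "\<mu> nonzero_mult \<noteq> 0"
    and "\<And>s. \<gamma> s = 1 / \<mu> nonzero_mult * complex_integral (borel_on nonzero_mult) \<mu> (\<lambda>\<rho>. \<rho> s)"
  shows "(\<forall>s t. \<mu> nonzero_mult * complex_integral (borel_on nonzero_mult) \<mu> (\<lambda>\<rho>. \<rho> s * cnj (\<rho> t))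
            = complex_integral (borel_on nonzero_mult) \<mu> (\<lambda>\<rho>. \<rho> s)
              * complex_integral (borel_on nonzero_mult) \<mu> (\<lambda>\<rho>. cnj (\<rho> t)))
     \<longleftrightarrow> (\<gamma> \<in> nonzero_mult \<and>
          (\<forall>E \<in> sets (borel_on nonzero_mult). \<mu> E = \<mu> nonzero_mult * dirac \<gamma> E))"
    (is "?factor \<longleftrightarrow> ?point")
proof -
  interpret character_measure \<mu>
    by unfold_locales (fact assms)+
  have SM: "nonzero_mult \<in> sets \<B>"
    using sets.top[of \<B>] by (simp add: space_\<B>)
  have eval: "complex_integral \<B> \<mu> (character_eval s) = complex_integral \<B> \<mu> (\<lambda>\<rho>. \<rho> s)"
    "complex_integral \<B> \<mu> (\<lambda>\<rho>. cnj (character_eval t \<rho>)) = complex_integral \<B> \<mu> (\<lambda>\<rho>. cnj (\<rho> t))"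
    "complex_integral \<B> \<mu> (\<lambda>\<rho>. character_eval s \<rho> * cnj (character_eval t \<rho>))
      = complex_integral \<B> \<mu> (\<lambda>\<rho>. \<rho> s * cnj (\<rho> t))" for s t
    by (intro complex_integral_cong; simp add: character_eval_def)+
  show ?thesis
  proof
    assume factor: ?factor
    have "mean (\<lambda>\<rho>. character_eval s \<rho> * cnj (character_eval t \<rho>)) =
        mean (character_eval s) * mean (\<lambda>\<rho>. cnj (character_eval t \<rho>))" for s t
      using factor[rule_format, of s t] nonzero unfolding mean_def eval by (simp add: field_simps)
    then obtain \<gamma>' where \<gamma>': "\<gamma>' \<in> nonzero_mult" "\<And>s. mean (character_eval s) = \<gamma>' s"
      "\<And>E. E \<in> sets \<B> \<Longrightarrow> \<gamma>' \<notin> E \<Longrightarrow> \<mu> E = 0"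
      using point_mass_of_factorization by blast
    have "\<gamma> s = \<gamma>' s" for s
      using \<gamma>'(2)[of s] by (simp add: assms(5) mean_def eval)
    then have "\<gamma> = \<gamma>'" by blast
    have "\<mu> E = \<mu> nonzero_mult * dirac \<gamma> E" if E: "E \<in> sets \<B>" for E
    proof (cases "\<gamma> \<in> E")
      case True
      have "E \<subseteq> nonzero_mult" using sets.sets_into_space[OF E] by (simp add: space_\<B>)
      have "\<mu> (nonzero_mult - E) = 0"
        using \<gamma>'(3)[of "nonzero_mult - E"] E SM True \<open>\<gamma> = \<gamma>'\<close> by auto
      \<comment> \<open>Additivity is available for the signed measures
        \<open>Re (c * \<mu>)\<close>; \<open>c = 1\<close> and \<open>c = \<i>\<close> together
        determine the complex value.\<close>
      moreover have "Re (c * \<mu> (nonzero_mult - E)) = Re (c * \<mu> nonzero_mult) - Re (c * \<mu> E)" for c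
        using signed_measure.Diff[OF signed_measure_Re E SM \<open>E \<subseteq> nonzero_mult\<close>] .
      ultimately have "Re (c * \<mu> E) = Re (c * \<mu> nonzero_mult)" for c
        by simp
      from this[of 1] this[of "\<i>"] have "\<mu> E = \<mu> nonzero_mult"
        by (simp add: complex_eq_iff)
      with True show ?thesis by (simp add: dirac_def)
    next
      case False
      then show ?thesis using \<gamma>'(3)[OF E] \<open>\<gamma> = \<gamma>'\<close> by (simp add: dirac_def)
    qed
    with \<gamma>'(1) \<open>\<gamma> = \<gamma>'\<close> show ?point by blast
  next
    assume ?point
    then have \<gamma>: "\<gamma> \<in> nonzero_mult" and \<mu>: "\<And>E. E \<in> sets \<B> \<Longrightarrow> \<mu> E = \<mu> nonzero_mult * dirac \<gamma> E"
      by auto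
    have \<gamma>M: "{\<gamma>} \<in> sets \<B>" using \<gamma> by (intro sets_compact) auto
    \<comment> \<open>Every measurable set avoiding \<open>\<gamma>\<close> has measure 0, so all
      four parts are concentrated at \<open>\<gamma>\<close> and each integral is a point
      evaluation.\<close>
    have "mass (nonzero_mult - {\<gamma>}) \<le> 4 * 0"
    proof (rule mass_le)
      show "cmod (\<mu> A) \<le> 0" if "A \<in> sets \<B>" "A \<subseteq> nonzero_mult - {\<gamma>}" for A
        using \<mu>[OF that(1)] that(2) by (auto simp: dirac_def indicator_def)
    qed (use \<gamma>M SM in auto)
    then have null: "mass (space \<B> - {\<gamma>}) = 0"
      using mass_nonneg[of "nonzero_mult - {\<gamma>}"] by (simp add: space_\<B>)
    have cnj: "(\<lambda>\<rho> :: 's \<Rightarrow> complex. cnj (\<rho> t)) \<in> borel_measurable \<B>" for t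
      using measurable_coordinate by (rule measurable_compose) (intro borel_measurable_continuous_onI continuous_intros)
    note point = complex_integral_point_mass[OF _ \<gamma>M null]
    show ?factor
      by (simp add: point measurable_coordinate cnj borel_measurable_times space_\<B>)
  qed
qed

end
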